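(* Suppose $\mathbf{x}_t=\mathbf{g}(\mathbf{z}_t)$ with $\mathbf{g}$ invertible and $\mathbf{z}_t=(z_{1,t},\dots,z_{n,t})$, and that the conditional distribution $p(z_{k,t}\mid\mathbf{z}_{t-1})$ may change across $m$ values $u_1,\dots,u_m$ of a context variable $\mathbf{u}$. Suppose the components of $\mathbf{z}_t$ are mutually independent conditional on $\mathbf{z}_{t-1}$ in each context. Let $\hat{\mathbf{g}}$ be an invertible function and $\hat{\mathbf{z}}_t=\hat{\mathbf{g}}(\mathbf{x}_t)$ for every $t$, and assume that the components of $\hat{\mathbf{z}}_t$ are also mutually independent conditional on $\hat{\mathbf{z}}_{t-1}$ in each context. Let $\eta_{kt}(u_r)\triangleq\log p(z_{k,t}\mid\mathbf{z}_{t-1},u_r)$ and, for $k=1,\dots,n$, $r=1,\dots,m$, $$\mathbf{v}_{k,t}(u_r)\triangleq\Big(\frac{\partial^2\eta_{kt}(u_r)}{\partial z_{k,t}\partial z_{l,t-1}}\Big)_{l=1}^n,\qquad \mathring{\mathbf{v}}_{k,t}(u_r)\triangleq\Big(\frac{\partial^3\eta_{kt}(u_r)}{\partial z_{k,t}^2\partial z_{l,t-1}}\Big)_{l=1}^n,$$ and, for $r=2,\dots,m$, $$\Delta_{k,r}\triangleq\frac{\partial\eta_{kt}(u_r)}{\partial z_{k,t}}-\frac{\partial\eta_{kt}(u_{r-1})}{\partial z_{k,t}},\qquad \Delta^2_{k,r}\triangleq\frac{\partial^2\eta_{kt}(u_r)}{\partial z_{k,t}^2}-\frac{\partial^2\eta_{kt}(u_{r-1})}{\partial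 z_{k,t}^2}.$$ Define $$\mathbf{s}_{k,t}\triangleq\big(\mathbf{v}_{k,t}(u_1)^{\intercal},\dots,\mathbf{v}_{k,t}(u_m)^{\intercal},\Delta_{k,2},\dots,\Delta_{k,m}\big)^{\intercal},\qquad \mathring{\mathbf{s}}_{k,t}\triangleq\big(\mathring{\mathbf{v}}_{k,t}(u_1)^{\intercal},\dots,\mathring{\mathbf{v}}_{k,t}(u_m)^{\intercal},\Delta^2_{k,2},\dots,\Delta^2_{k,m}\big)^{\intercal}.$$ If the $2n$ function vectors $\mathbf{s}_{k,t}$ and $\mathring{\mathbf{s}}_{k,t}$, $k=1,\dots,n$, are linearly independent, then $\hat{\mathbf{z}}_t$ is a permuted invertible component-wise transformation of $\mathbf{z}_t$.
   Context: Setting (time lag one): in each context $u_r$, $\{\mathbf{z}_t\}$ is an unobserved process in $\mathbb{R}^n$ that depends on the past only through $\mathbf{z}_{t-1}$, with transition law $p(\mathbf{z}_t\mid\mathbf{z}_{t-1},u_r)=\prod_k p(z_{k,t}\mid\mathbf{z}_{t-1},u_r)$. The functions $\mathbf{g}$ and $\hat{\mathbf{g}}$ are the same in all contexts. Regularity: in each context, $\mathbf{z}_{t-1}$ has a positive density on $\mathbb{R}^n$, each conditional density $p(z_{k,t}\mid\mathbf{z}_{t-1},u_r)$ is positive on $\mathbb{R}$, all partial derivatives of $\eta_{kt}(u_r)$ that appear exist, and $\mathbf{h}=\mathbf{g}^{-1}\circ\hat{\mathbf{g}}^{-1}$ (so that $\mathbf{z}_t=\mathbf{h}(\hat{\mathbf{z}}_t)$)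 is a $C^3$ diffeomorphism from an open subset of $\mathbb{R}^n$ onto $\mathbb{R}^n$. Linear independence is understood as: for each fixed value of $\mathbf{z}_t$, as functions of $\mathbf{z}_{t-1}$, i.e. there are no constants $\alpha_k,\mathring\alpha_k$ ($k=1,\dots,n$), not all zero, with $\sum_k(\alpha_k\mathbf{s}_{k,t}+\mathring\alpha_k\mathring{\mathbf{s}}_{k,t})=\mathbf{0}$ for all values of $\mathbf{z}_{t-1}$. "$\hat{\mathbf{z}}_t$ is a permuted invertible component-wise transformation of $\mathbf{z}_t$" means: there are a permutation $\pi$ of $\{1,\dots,n\}$ and invertible scalar functions $T_1,\dots,T_n$ with $\hat z_{k,t}=T_k(z_{\pi(k),t})$ for all $k$. *)

theory Defs
  imports "HOL-Probability.Probability"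
begin

definition past_algebra :: "'a measure \<Rightarrow> (nat \<Rightarrow> 'a \<Rightarrow> real ^ 'n) \<Rightarrow> nat \<Rightarrow> 'a measure" where
  "past_algebra M Z s =
     vimage_algebra (space M) (\<lambda>\<omega>. \<lambda>i\<in>{..<s}. Z i \<omega>) (\<Pi>\<^sub>M i\<in>{..<s}. borel)"

(* Mutual independence of the family X given the sub-sigma-algebra F. Taking A k = UNIV for some
   of the k gives the product formula for every subfamily. *)
definition cond_indep_components ::
    "'a measure \<Rightarrow> 'a measure \<Rightarrow> ('a \<Rightarrow> real ^ 'n) \<Rightarrow> bool" where
  "cond_indep_components M F X \<longleftrightarrow>
     subalgebra M F \<and> X \<in> borel_measurable M \<and>
     (\<forall>A :: 'n \<Rightarrow> real set. (\<forall>k. A k \<in> sets borel) \<longrightarrow>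
        (AE \<omega> in M. real_cond_exp M F (\<lambda>\<omega>. \<Prod>k\<in>UNIV. indicator (A k) (X \<omega> $ k)) \<omega> =
                    (\<Prod>k\<in>UNIV. real_cond_exp M F (\<lambda>\<omega>. indicator (A k) (X \<omega> $ k)) \<omega>)))"

(* p s k x y is the conditional density of the k-th component of Z s at x, given Z (s - 1) = y.
   Conditioning on the whole past Z 0, ..., Z (s - 1) yields a law that depends on Z (s - 1) only
   and has density (\<Prod>k. p s k (z $ k) y) at z. *)
definition lag_one_process ::
    "'a measure \<Rightarrow> (nat \<Rightarrow> 'a \<Rightarrow> real ^ 'n) \<Rightarrow>
     (nat \<Rightarrow> 'n \<Rightarrow> real \<Rightarrow> real ^ 'n \<Rightarrow> real) \<Rightarrow> bool" where
  "lag_one_process M Z p \<longleftrightarrow>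
     prob_space M \<and>
     (\<forall>s. Z s \<in> borel_measurable M) \<and>
     (\<forall>s>0.
        (\<forall>k. (\<lambda>(x, y). p s k x y) \<in> borel_measurable (borel \<Otimes>\<^sub>M borel)) \<and>
        (\<forall>k x y. 0 \<le> p s k x y) \<and>
        (\<forall>k y. (\<integral>\<^sup>+ x. ennreal (p s k x y) \<partial>lborel) = 1) \<and>
        (\<forall>A\<in>sets borel. AE \<omega> in M.
           real_cond_exp M (past_algebra M Z s) (indicator (Z s -` A \<inter> space M)) \<omega> =
           (LINT z:A|lborel. (\<Prod>k\<in>UNIV. p s k (z $ k) (Z (s - 1) \<omega>)))))"

primrec Ck_on :: "nat \<Rightarrow> ('a::real_normed_vector \<Rightarrow> 'b::real_normed_vector) \<Rightarrow> 'a set \<Rightarrow> bool" where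
  "Ck_on 0 f S \<longleftrightarrow> continuous_on S f"
| "Ck_on (Suc k) f S \<longleftrightarrow>
     (\<forall>x\<in>S. f differentiable (at x)) \<and> (\<forall>v. Ck_on k (\<lambda>x. frechet_derivative f (at x) v) S)"

definition Ck_diffeomorphism ::
    "nat \<Rightarrow> ('a::real_normed_vector \<Rightarrow> 'b::real_normed_vector) \<Rightarrow> 'a set \<Rightarrow> 'b set \<Rightarrow> bool" where
  "Ck_diffeomorphism k h U V \<longleftrightarrow>
     open U \<and> open V \<and> bij_betw h U V \<and> Ck_on k h U \<and> Ck_on k (inv_into U h) V"

(* The map inverse g o inverse ghat. Its domain is range (ghat o g); ghat only needs to be
   invertible on the observation space range g. *)
definition latent_map :: "(real ^ 'n \<Rightarrow> 'x) \<Rightarrow> ('x \<Rightarrow> real ^ 'n) \<Rightarrow> real ^ 'n \<Rightarrow> real ^ 'n" where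
  "latent_map g ghat = inv g \<circ> inv_into (range g) ghat"

(* Functions e x y of a current component x = z_{k,t} and the previous state y = z_{t-1}:
   pd_cur is the partial derivative in x, pd_prev l the one in the l-th coordinate of y.
   Mixed derivatives use the convention d^2/(dx dy_l) = d/dx (d/dy_l). *)
definition pd_cur :: "(real \<Rightarrow> real ^ 'n \<Rightarrow> real) \<Rightarrow> real \<Rightarrow> real ^ 'n \<Rightarrow> real" where
  "pd_cur e x y = deriv (\<lambda>a. e a y) x"

definition pd_prev :: "'n \<Rightarrow> (real \<Rightarrow> real ^ 'n \<Rightarrow> real) \<Rightarrow> real \<Rightarrow> real ^ 'n \<Rightarrow> real" where
  "pd_prev l e x y = deriv (\<lambda>a. e x (y + a *\<^sub>R axis l 1)) 0"

definition has_pd_cur :: "(real \<Rightarrow> real ^ 'n \<Rightarrow> real) \<Rightarrow> bool" where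
  "has_pd_cur e \<longleftrightarrow> (\<forall>x y. (\<lambda>a. e a y) differentiable (at x))"

definition has_pd_prev :: "'n \<Rightarrow> (real \<Rightarrow> real ^ 'n \<Rightarrow> real) \<Rightarrow> bool" where
  "has_pd_prev l e \<longleftrightarrow> (\<forall>x y. (\<lambda>a. e x (y + a *\<^sub>R axis l 1)) differentiable (at 0))"

definition partials_exist :: "(real \<Rightarrow> real ^ 'n \<Rightarrow> real) \<Rightarrow> bool" where
  "partials_exist e \<longleftrightarrow>
     has_pd_cur e \<and> has_pd_cur (pd_cur e) \<and>
     (\<forall>l. has_pd_prev l e \<and> has_pd_cur (pd_prev l e) \<and> has_pd_cur (pd_cur (pd_prev l e)))"

definition log_density :: "(real \<Rightarrow> real ^ 'n \<Rightarrow> real) \<Rightarrow> real \<Rightarrow> real ^ 'n \<Rightarrow> real" where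
  "log_density f x y = ln (f x y)"

(* Positions of the entries of the stacked vectors: Inl (r, l) is the l-th entry of the block
   of context r, Inr r is the difference between contexts r and r - 1. *)
definition entries :: "nat \<Rightarrow> ((nat \<times> 'n) + nat) set" where
  "entries m = Inl ` ({1..m} \<times> UNIV) \<union> Inr ` {2..m}"

definition s_vec ::
    "(nat \<Rightarrow> real \<Rightarrow> real ^ 'n \<Rightarrow> real) \<Rightarrow> real \<Rightarrow> real ^ 'n \<Rightarrow> (nat \<times> 'n) + nat \<Rightarrow> real" where
  "s_vec \<eta> x y i = (case i of
       Inl (r, l) \<Rightarrow> pd_cur (pd_prev l (\<eta> r)) x y
     | Inr r \<Rightarrow> pd_cur (\<eta> r) x y - pd_cur (\<eta> (r - 1)) x y)"

definition s_ring_vec ::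
    "(nat \<Rightarrow> real \<Rightarrow> real ^ 'n \<Rightarrow> real) \<Rightarrow> real \<Rightarrow> real ^ 'n \<Rightarrow> (nat \<times> 'n) + nat \<Rightarrow> real" where
  "s_ring_vec \<eta> x y i = (case i of
       Inl (r, l) \<Rightarrow> pd_cur (pd_cur (pd_prev l (\<eta> r))) x y
     | Inr r \<Rightarrow> pd_cur (pd_cur (\<eta> r)) x y - pd_cur (pd_cur (\<eta> (r - 1))) x y)"

(* Linear independence, as functions of y with values in R^I, of the two families taken
   together, i.e. of 2 CARD('n) vectors counted with multiplicity. *)
definition lin_indep_functions ::
    "'i set \<Rightarrow> ('n::finite \<Rightarrow> 'y \<Rightarrow> 'i \<Rightarrow> real) \<Rightarrow> ('n \<Rightarrow> 'y \<Rightarrow> 'i \<Rightarrow> real) \<Rightarrow> bool" where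
  "lin_indep_functions I s s' \<longleftrightarrow>
     (\<forall>\<alpha> \<alpha>'. (\<forall>y. \<forall>i\<in>I. (\<Sum>k\<in>UNIV. \<alpha> k * s k y i + \<alpha>' k * s' k y i) = 0)
        \<longrightarrow> (\<forall>k. \<alpha> k = 0 \<and> \<alpha>' k = 0))"

end

theory Submission
  imports Defs
begin

text \<open>Write \<open>\<phi> = ghat \<circ> g\<close> with inverse \<open>h\<close>. Conditional independence says that, for almost every
  \<open>y\<close>, the law of \<open>\<phi>(z)\<close> with \<open>z\<close> distributed as \<open>z\<^sub>t\<close> given \<open>z\<^sub>t\<^sub>-\<^sub>1 = y\<close> is a product measure. The masses of
  small boxes around four points that form a rectangle in the coordinates \<open>i\<close>, \<open>j\<close> therefore satisfy
  a multiplicative relation. Dividing by the Lebesgue measures of the preimages of the boxes and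
  shrinking them, the alternating sum of \<open>\<Sum>k. \<eta> k r (h w $ k) y\<close> over the four corners \<open>w\<close> tends to a
  limit that involves neither \<open>y\<close> nor the context \<open>r\<close>; this takes the place of a change of variables
  with the Jacobian. The exceptional null set of \<open>y\<close> disappears because \<open>\<eta>\<close> is separately
  continuous in \<open>y\<close>. Differentiating in \<open>y\<^sub>l\<close>, or subtracting two contexts, gives vanishing alternating
  sums for every entry of the stacked vectors. Two more derivatives, in the directions \<open>i\<close> and \<open>j\<close>, give a
  linear relation between the \<open>s\<close> and \<open>s_ring\<close> vectors whose coefficients are
  \<open>\<partial>\<^sub>i \<partial>\<^sub>j h\<^sub>k\<close> and \<open>\<partial>\<^sub>i h\<^sub>k \<cdot> \<partial>\<^sub>j h\<^sub>k\<close>. So each row of the derivative of \<open>h\<close>, hence of that of \<open>\<phi>\<close>, has exactly one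
  nonzero entry, and its position is constant since \<open>\<real>\<^sup>n\<close> is connected.\<close>

section \<open>Measurability of coordinates and boxes\<close>

lemma borel_measurable_vec_nth:
  fixes f :: "'a \<Rightarrow> real ^ 'n"
  assumes "f \<in> borel_measurable M"
  shows "(\<lambda>x. f x $ k) \<in> borel_measurable M"
  using assms by (simp add: cart_eq_inner_axis)

lemma sets_borel_box:
  fixes f :: "real ^ 'n \<Rightarrow> real ^ 'n"
  assumes "f \<in> borel_measurable borel" "\<And>k. A k \<in> sets borel"
  shows "{z. \<forall>k. f z $ k \<in> A k} \<in> sets borel"
proof -
  have "(\<lambda>z. f z $ k) -` A k \<inter> space borel \<in> sets borel" for k
    by (intro measurable_sets[where A=borel] borel_measurable_vec_nth assms)
  then have "(\<Inter>k. (\<lambda>z. f z $ k) -` A k) \<in> sets borel"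
    by (intro sets.countable_INT) auto
  moreover have "(\<Inter>k. (\<lambda>z. f z $ k) -` A k) = {z. \<forall>k. f z $ k \<in> A k}" by auto
  ultimately show ?thesis by simp
qed

subsection \<open>Separately continuous functions and averages\<close>

lemma emeasure_lborel_open_pos:
  fixes S :: "'a::euclidean_space set"
  assumes "open S" "x \<in> S"
  shows "0 < emeasure lborel S"
proof -
  have "S \<notin> null_sets lborel"
    using open_not_negligible[OF assms(1)] assms(2) null_sets_completionI[of S lborel]
    by (auto simp: negligible_iff_null_sets)
  moreover have "S \<in> sets lborel" using assms(1) by simp
  ultimately show ?thesis by (auto simp: null_sets_def zero_less_iff_neq_zero)
qed

text \<open>Openness is asked only along axis-parallel lines, so \<open>E\<close> itself may fail to
  be open. Induction on the coordinates with Tonelli: the line through \<open>x\<close> in the new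
  direction \<open>i\<close> meets \<open>E\<close> in a nonempty open set, and over each of its
  points the fibre has positive measure by the induction hypothesis.\<close>

lemma emeasure_PiM_separately_open_pos:
  assumes "finite I" "E \<in> sets (\<Pi>\<^sub>M i\<in>I. (lborel :: real measure))" "x \<in> E"
    and "\<And>y i. y \<in> E \<Longrightarrow> i \<in> I \<Longrightarrow> open {a. y(i := a) \<in> E}"
  shows "0 < emeasure (\<Pi>\<^sub>M i\<in>I. (lborel :: real measure)) E"
  using assms
proof (induction I arbitrary: E x rule: finite_induct)
  case empty
  then have "E = {\<lambda>k. undefined}"
    using sets.sets_into_space[OF empty.prems(1)] by (auto simp: space_PiM)
  then show ?case by (simp add: emeasure_PiM_empty)
next
  case (insert i I)
  let ?P = "\<lambda>I. \<Pi>\<^sub>M i\<in>I. (lborel :: real measure)"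
  interpret product_sigma_finite "\<lambda>_. lborel :: real measure" by standard
  define S where "S a = {y \<in> space (?P I). y(i := a) \<in> E}" for a
  have upd: "(\<lambda>y. y(i := a)) \<in> measurable (?P I) (?P (insert i I))" for a
    by measurable
  have S_sets: "S a \<in> sets (?P I)" for a
    using measurable_sets[OF upd insert.prems(1), of a]
    by (auto simp: S_def vimage_def Int_def conj_commute)
  have E_sub: "E \<subseteq> space (?P (insert i I))"
    using insert.prems(1) by (rule sets.sets_into_space)
  \<comment> \<open>The fibre contains \<open>x\<close> with coordinate \<open>i\<close> dropped,
    and it inherits open sections from \<open>E\<close>.\<close>
  have pos: "0 < emeasure (?P I) (S a)" if a: "x(i := a) \<in> E" for a
  proof (rule insert.IH[OF S_sets])
    let ?x = "restrict x I"
    have "?x(i := a) = x(i := a)"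
      using E_sub insert.prems(2) insert.hyps(2) by (fastforce simp: space_PiM PiE_def extensional_def)
    then show "?x \<in> S a"
      using a by (simp add: S_def space_PiM)
    fix y j assume y: "y \<in> S a" and j: "j \<in> I"
    then have ij: "i \<noteq> j" using insert.hyps by auto
    have "open {b. (y(i := a))(j := b) \<in> E}"
    proof (rule insert.prems(3))
      show "y(i := a) \<in> E" using y unfolding S_def by blast
    qed (use j in simp)
    moreover have "y(j := b) \<in> space (?P I)" for b
      using y j by (auto simp: S_def space_PiM PiE_def extensional_def)
    ultimately show "open {b. y(j := b) \<in> S a}"
      using ij by (simp add: S_def fun_upd_twist)
  qed
  have eq: "emeasure (?P (insert i I)) E = (\<integral>\<^sup>+ a. emeasure (?P I) (S a) \<partial>lborel)"
  proof -
    have "emeasure (?P (insert i I)) E = (\<integral>\<^sup>+ y. indicator E y \<partial>?P (insert i I))"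
      using insert.prems(1) by simp
    also have "\<dots> = (\<integral>\<^sup>+ a. \<integral>\<^sup>+ y. indicator E (y(i := a)) \<partial>?P I \<partial>lborel)"
      using insert.prems(1) insert.hyps
      by (intro product_nn_integral_insert_rev) auto
    also have "\<dots> = (\<integral>\<^sup>+ a. \<integral>\<^sup>+ y. indicator (S a) y \<partial>?P I \<partial>lborel)"
      by (intro nn_integral_cong) (auto simp: S_def indicator_def)
    finally show ?thesis using S_sets by simp
  qed
  have meas: "(\<lambda>a. emeasure (?P I) (S a)) \<in> borel_measurable lborel"
  proof -
    interpret I: sigma_finite_measure "?P I" by (rule sigma_finite[OF insert.hyps(1)])
    have "(\<lambda>(a, y). y(i := a)) \<in> measurable (lborel \<Otimes>\<^sub>M ?P I) (?P (insert i I))"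
      by measurable
    then have "(\<lambda>(a, y). indicator E (y(i := a)) :: ennreal) \<in> borel_measurable (lborel \<Otimes>\<^sub>M ?P I)"
      using insert.prems(1) by measurable
    then have "(\<lambda>a. \<integral>\<^sup>+ y. indicator E (y(i := a)) \<partial>?P I) \<in> borel_measurable lborel"
      by (intro I.borel_measurable_nn_integral)
    moreover have "(\<integral>\<^sup>+ y. indicator E (y(i := a)) \<partial>?P I) = emeasure (?P I) (S a)" for a
    proof -
      have "(\<integral>\<^sup>+ y. indicator E (y(i := a)) \<partial>?P I) = (\<integral>\<^sup>+ y. indicator (S a) y \<partial>?P I)"
        by (intro nn_integral_cong) (auto simp: S_def indicator_def)
      then show ?thesis using S_sets by simp
    qed
    ultimately show ?thesis by simp
  qed
  show ?case
  proof (rule ccontr)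
    \<comment> \<open>A vanishing integral makes almost every fibre null, which by
      \<open>pos\<close> makes the nonempty open line section through \<open>x\<close> null as
      well.\<close>
    assume "\<not> ?thesis"
    then have "AE a in lborel. emeasure (?P I) (S a) = 0"
      using meas by (simp add: eq nn_integral_0_iff_AE)
    then have "AE a in lborel. a \<notin> {a. x(i := a) \<in> E}"
    proof eventually_elim
      case (elim a)
      then show ?case using pos[of a] by (metis less_irrefl mem_Collect_eq)
    qed
    moreover have op: "open {a. x(i := a) \<in> E}"
      by (rule insert.prems(3)[OF insert.prems(2)]) simp
    ultimately have "{a. x(i := a) \<in> E} \<in> null_sets lborel"
      by (subst AE_iff_null_sets) auto
    moreover have "x i \<in> {a. x(i := a) \<in> E}" using insert.prems by simp
    from emeasure_lborel_open_pos[OF op this]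
    have "emeasure lborel {a. x(i := a) \<in> E} \<noteq> 0" by (rule less_imp_neq[symmetric])
    ultimately show False by (metis null_setsD1)
  qed
qed

text \<open>Partial derivatives of \<open>\<eta>\<close> in the previous state yield continuity
  along coordinate lines only, so density of the good set would not be enough. The set where
  \<open>f\<close> differs from \<open>c\<close> has open axis-parallel sections; if nonempty, it
  would have positive measure.\<close>

lemma AE_lborel_const_separately_continuous:
  fixes f :: "'a::euclidean_space \<Rightarrow> real"
  assumes "f \<in> borel_measurable borel"
    and cont: "\<And>y b. b \<in> Basis \<Longrightarrow> continuous_on UNIV (\<lambda>a. f (y + a *\<^sub>R b))"
    and "AE y in lborel. f y = c"
  shows "f y = c"
proof (rule ccontr)
  assume ny: "f y \<noteq> c"
  let ?P = "\<Pi>\<^sub>M b\<in>(Basis::'a set). (lborel :: real measure)"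
  \<comment> \<open>\<open>J\<close> rebuilds a vector from its coordinates. Lebesgue measure is the
    image of the product measure under \<open>J\<close>, so the product lemma applies to the
    pullback of the bad set.\<close>
  define J where "J w = (\<Sum>b\<in>Basis. w b *\<^sub>R b)" for w :: "'a \<Rightarrow> real"
  have J: "J \<in> measurable ?P borel" unfolding J_def by measurable
  define E where "E = {w \<in> space ?P. f (J w) \<noteq> c}"
  have [measurable]: "f \<in> borel_measurable borel" by fact
  note J[measurable]
  have E: "E \<in> sets ?P" unfolding E_def by measurable
  have "0 < emeasure ?P E"
  proof (rule emeasure_PiM_separately_open_pos[OF _ E])
    have "J (\<lambda>b\<in>Basis. y \<bullet> b) = y" by (simp add: J_def euclidean_representation)
    then show "(\<lambda>b\<in>Basis. y \<bullet> b) \<in> E" using ny by (simp add: E_def space_PiM)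
    fix w i assume w: "w \<in> E" and i: "i \<in> (Basis :: 'a set)"
    have J_upd: "J (w(i := a)) = (\<Sum>b\<in>Basis - {i}. w b *\<^sub>R b) + a *\<^sub>R i" for a
    proof -
      have "J (w(i := a)) = a *\<^sub>R i + (\<Sum>b\<in>Basis - {i}. (w(i := a)) b *\<^sub>R b)"
        unfolding J_def using i by (subst sum.remove[of Basis i]) auto
      also have "(\<Sum>b\<in>Basis - {i}. (w(i := a)) b *\<^sub>R b) = (\<Sum>b\<in>Basis - {i}. w b *\<^sub>R b)"
        by (intro sum.cong) auto
      finally show ?thesis by (simp only: add.commute)
    qed
    have "w(i := a) \<in> space ?P" for a
      using w i by (auto simp: E_def space_PiM PiE_def extensional_def)
    then have "{a. w(i := a) \<in> E} = (\<lambda>a. f ((\<Sum>b\<in>Basis - {i}. w b *\<^sub>R b) + a *\<^sub>R i)) -` (- {c})"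
      by (auto simp: E_def J_upd)
    then show "open {a. w(i := a) \<in> E}"
      using cont[OF i] by (auto intro!: open_vimage)
  qed simp
  moreover have lborel_J: "(lborel :: 'a measure) = distr ?P borel J"
    unfolding J_def by (rule lborel_eq)
  have "AE w in ?P. f (J w) = c"
    using assms(3)[unfolded lborel_J] by (subst (asm) AE_distr_iff[OF J]) auto
  then have "AE w in ?P. w \<notin> E" by eventually_elim (simp add: E_def)
  then have "E \<in> null_sets ?P" using E by (subst AE_iff_null_sets)
  ultimately show False by (auto simp: null_sets_def)
qed

text \<open>The average deviates from \<open>f z\<close> by at most the oscillation of
  \<open>f\<close> on \<open>B n\<close>. The shape of \<open>B n\<close> is arbitrary, which suits
  preimages of boxes under a nonlinear map.\<close>

lemma shrinking_averages_tendsto: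
  fixes f :: "'a::euclidean_space \<Rightarrow> real"
  assumes f: "continuous_on UNIV f" and B: "\<And>n. open (B n)" "\<And>n. z \<in> B n"
    and shrink: "\<And>e. 0 < e \<Longrightarrow> \<forall>\<^sub>F n in sequentially. B n \<subseteq> ball z e"
  shows "(\<lambda>n. (LINT x:B n|lborel. f x) / measure lborel (B n)) \<longlonglongrightarrow> f z"
    and "\<forall>\<^sub>F n in sequentially. 0 < measure lborel (B n)"
proof -
  \<comment> \<open>\<open>measure\<close> is 0 on sets of infinite measure, so positivity is
    claimed only once \<open>B n\<close> lies in a ball.\<close>
  have meas: "0 < measure lborel (B n)" "emeasure lborel (B n) < \<infinity>" if "B n \<subseteq> ball z e" for n e
  proof -
    have "bounded (B n)" using that bounded_subset by blast
    then show fin: "emeasure lborel (B n) < \<infinity>"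
      by (rule emeasure_bounded_finite)
    have "0 < emeasure lborel (B n)" using emeasure_lborel_open_pos B by blast
    then show "0 < measure lborel (B n)"
      using fin by (simp add: measure_def enn2real_positive_iff)
  qed
  show "\<forall>\<^sub>F n in sequentially. 0 < measure lborel (B n)"
    using shrink[OF zero_less_one] by eventually_elim (use meas in blast)
  show "(\<lambda>n. (LINT x:B n|lborel. f x) / measure lborel (B n)) \<longlonglongrightarrow> f z"
  proof (rule tendstoI)
    fix e :: real assume e: "0 < e"
    have "isCont f z" using f by (simp add: continuous_on_eq_continuous_at)
    then obtain d where d: "0 < d" "\<And>x. dist x z < d \<Longrightarrow> dist (f x) (f z) < e/2"
      using e unfolding continuous_at_eps_delta by (metis half_gt_zero)
    show "\<forall>\<^sub>F n in sequentially. dist ((LINT x:B n|lborel. f x) / measure lborel (B n)) (f z) < e"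
      using shrink[OF d(1)]
    proof eventually_elim
      case (elim n)
      let ?m = "measure lborel (B n)"
      have bd: "\<bar>f x - f z\<bar> \<le> e/2" if "x \<in> B n" for x
        using d(2)[of x] elim that by (fastforce simp: dist_real_def dist_commute)
      have fin: "emeasure lborel (B n) < \<infinity>" and m: "0 < ?m" using meas elim by blast+
      have [measurable]: "B n \<in> sets borel" using B by auto
      have [measurable]: "f \<in> borel_measurable borel"
        using f by (rule borel_measurable_continuous_onI)
      have i1: "set_integrable lborel (B n) (\<lambda>_. c)" for c :: real
        using fin unfolding set_integrable_def by simp
      have i2: "set_integrable lborel (B n) f"
        unfolding set_integrable_def
      proof (rule Bochner_Integration.integrable_bound)
        show "integrable lborel (\<lambda>x. indicat_real (B n) x *\<^sub>R (\<bar>f z\<bar> + e/2))"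
          using i1 unfolding set_integrable_def .
        show "AE x in lborel. norm (indicat_real (B n) x *\<^sub>R f x)
            \<le> norm (indicat_real (B n) x *\<^sub>R (\<bar>f z\<bar> + e/2))"
        proof (intro AE_I2)
          fix x
          have "\<bar>f x\<bar> \<le> \<bar>\<bar>f z\<bar> + e/2\<bar>" if "x \<in> B n" using bd[OF that] e by linarith
          then show "norm (indicat_real (B n) x *\<^sub>R f x) \<le> norm (indicat_real (B n) x *\<^sub>R (\<bar>f z\<bar> + e/2))"
            by (simp add: indicator_def)
        qed
      qed measurable
      have "(LINT x:B n|lborel. f x) - ?m * f z = (LINT x:B n|lborel. f x - f z)"
        using i1 i2 by (subst set_integral_diff) (auto simp: set_lebesgue_integral_def)
      also have "\<bar>\<dots>\<bar> \<le> (LINT x:B n|lborel. e/2)"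
      proof -
        have "norm (LINT x:B n|lborel. f x - f z) \<le> (LINT x|lborel. norm (indicat_real (B n) x *\<^sub>R (f x - f z)))"
          unfolding set_lebesgue_integral_def by (rule integral_norm_bound)
        also have "\<dots> \<le> (LINT x:B n|lborel. e/2)"
          unfolding set_lebesgue_integral_def
        proof (rule integral_mono)
          show "integrable lborel (\<lambda>x. norm (indicat_real (B n) x *\<^sub>R (f x - f z)))"
            using set_integral_diff(1)[OF i2 i1[of "f z"]] unfolding set_integrable_def
            by (rule integrable_norm)
          show "integrable lborel (\<lambda>x. indicat_real (B n) x *\<^sub>R (e/2))"
            using i1 unfolding set_integrable_def .
        qed (use bd in \<open>auto simp: indicator_def\<close>)
        finally show ?thesis by simp
      qed
      also have "\<dots> = ?m * (e/2)" by (simp add: set_lebesgue_integral_def)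
      finally have "\<bar>(LINT x:B n|lborel. f x) - ?m * f z\<bar> \<le> ?m * (e/2)" .
      then have "\<bar>(LINT x:B n|lborel. f x) / ?m - f z\<bar> \<le> e/2"
        using m by (simp add: abs_le_iff field_simps)
      then show ?case using e by (simp add: dist_real_def)
    qed
  qed
qed

subsection \<open>Box probabilities of a lag-one process\<close>

text \<open>\<open>H (p t) A y\<close> is the probability that the transformed state falls in the
  box \<open>A\<close> when the previous state is \<open>y\<close>. Conditioning on the whole past
  gives \<open>H\<close> at \<open>Z (t - 1)\<close>. This is already measurable with respect to
  \<open>Zhat (t - 1)\<close>, because \<open>\<psi>\<close> recovers \<open>Z (t - 1)\<close> from
  it, so conditioning on that coarser algebra leaves it unchanged; there conditional independence
  factors the box event.\<close>

lemma lag_one_transition_AE: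
  fixes Z Zhat :: "nat \<Rightarrow> 'a \<Rightarrow> real ^ 'n" and \<phi> \<psi> :: "real ^ 'n \<Rightarrow> real ^ 'n"
  defines "H \<equiv> \<lambda>p A y. LINT z:{z. \<forall>k. \<phi> z $ k \<in> A k}|lborel. (\<Prod>k\<in>UNIV. p k (z $ k) y)"
  assumes process: "lag_one_process M Z p" and t: "0 < t"
    and \<phi>: "\<phi> \<in> borel_measurable borel" and \<psi>: "\<psi> \<in> borel_measurable borel" "\<And>z. \<psi> (\<phi> z) = z"
    and Zhat: "\<And>s \<omega>. \<omega> \<in> space M \<Longrightarrow> Zhat s \<omega> = \<phi> (Z s \<omega>)"
    and indep: "cond_indep_components M (vimage_algebra (space M) (Zhat (t - 1)) borel) (Zhat t)"
    and A: "\<And>k. A k \<in> sets borel"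
  shows "AE \<omega> in M. H (p t) A (Z (t - 1) \<omega>) =
    (\<Prod>k\<in>UNIV. real_cond_exp M (vimage_algebra (space M) (Zhat (t - 1)) borel)
        (\<lambda>\<omega>. indicator (A k) (Zhat t \<omega> $ k)) \<omega>)"
    and "H (p t) A \<in> borel_measurable borel"
proof -
  let ?F = "vimage_algebra (space M) (Zhat (t - 1)) borel"
  let ?G = "past_algebra M Z t"
  let ?B = "{z. \<forall>k. \<phi> z $ k \<in> A k}"
  note [measurable] = \<phi> \<psi>(1)
  interpret prob_space M using process by (simp add: lag_one_process_def)
  have Z[measurable]: "Z s \<in> borel_measurable M" for s
    using process by (simp add: lag_one_process_def)
  have p_meas: "(\<lambda>(x, y). p t k x y) \<in> borel_measurable (borel \<Otimes>\<^sub>M borel)" for k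
    using process t by (simp add: lag_one_process_def)
  have B[measurable]: "?B \<in> sets borel" using \<phi> A by (rule sets_borel_box)
  have trans: "AE \<omega> in M. real_cond_exp M ?G (indicator (Z t -` ?B \<inter> space M)) \<omega> = H (p t) A (Z (t - 1) \<omega>)"
    using process t B unfolding lag_one_process_def H_def by blast
  have "(\<lambda>(z, y). p t k (z $ k) y) \<in> borel_measurable (borel \<Otimes>\<^sub>M borel)" for k :: 'n
  proof -
    have "(\<lambda>(z :: real ^ 'n, y :: real ^ 'n). (z $ k, y)) \<in> measurable (borel \<Otimes>\<^sub>M borel) (borel \<Otimes>\<^sub>M borel)"
      unfolding case_prod_beta
      by (rule measurable_Pair[OF borel_measurable_vec_nth[OF measurable_fst] measurable_snd])
    from measurable_compose[OF this p_meas[of k]] show ?thesis by (simp add: case_prod_beta)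
  qed
  then have "(\<lambda>(z, y). \<Prod>k\<in>UNIV. p t k (z $ k) y) \<in> borel_measurable (borel \<Otimes>\<^sub>M borel)"
    unfolding case_prod_beta by (intro borel_measurable_prod)
  from measurable_compose[OF measurable_pair_swap' this]
  have prod_meas: "(\<lambda>(y, z). \<Prod>k\<in>UNIV. p t k (z $ k) y) \<in> borel_measurable (borel \<Otimes>\<^sub>M borel)"
    by (simp add: case_prod_beta)
  have "(\<lambda>(y :: real ^ 'n, z). indicat_real ?B z) \<in> borel_measurable (borel \<Otimes>\<^sub>M borel)"
    unfolding case_prod_beta by (rule measurable_compose[OF measurable_snd borel_measurable_indicator[OF B]])
  then have "(\<lambda>(y, z). indicat_real ?B z *\<^sub>R (\<Prod>k\<in>UNIV. p t k (z $ k) y)) \<in> borel_measurable (borel \<Otimes>\<^sub>M borel)"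
    using prod_meas unfolding case_prod_beta by (rule borel_measurable_scaleR)
  moreover have "sets (borel \<Otimes>\<^sub>M lborel) = sets (borel \<Otimes>\<^sub>M borel)"
    by (intro sets_pair_measure_cong) simp_all
  ultimately have "(\<lambda>(y, z). indicat_real ?B z *\<^sub>R (\<Prod>k\<in>UNIV. p t k (z $ k) y)) \<in> borel_measurable (borel \<Otimes>\<^sub>M lborel)"
    using measurable_cong_sets by blast
  then show H_meas: "H (p t) A \<in> borel_measurable borel"
    unfolding H_def set_lebesgue_integral_def by (rule lborel.borel_measurable_lebesgue_integral)
  have sub_F: "subalgebra M ?F" and Zhat_meas[measurable]: "Zhat t \<in> borel_measurable M"
    and factor: "AE \<omega> in M. real_cond_exp M ?F (\<lambda>\<omega>. \<Prod>k\<in>UNIV. indicator (A k) (Zhat t \<omega> $ k)) \<omega> =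
            (\<Prod>k\<in>UNIV. real_cond_exp M ?F (\<lambda>\<omega>. indicator (A k) (Zhat t \<omega> $ k)) \<omega>)"
    using indep A by (auto simp: cond_indep_components_def)
  have Z_past: "(\<lambda>\<omega>. \<lambda>i\<in>{..<t}. Z i \<omega>) \<in> measurable M (\<Pi>\<^sub>M i\<in>{..<t}. borel)"
    by measurable
  have sub_G: "subalgebra M ?G"
    unfolding subalgebra_def past_algebra_def by (simp add: sets_image_in_sets[OF _ Z_past])
  have "(\<lambda>\<omega>. \<lambda>i\<in>{..<t}. Z i \<omega>) \<in> measurable ?G (\<Pi>\<^sub>M i\<in>{..<t}. borel)"
    unfolding past_algebra_def by (rule measurable_vimage_algebra1) (auto simp: space_PiM)
  from measurable_compose[OF this measurable_component_singleton[of "t - 1"]]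
  have Z_G[measurable]: "Z (t - 1) \<in> borel_measurable ?G" using t by simp
  have "\<phi> \<circ> Z (t - 1) \<in> borel_measurable ?G" by measurable
  then have Zhat_G: "Zhat (t - 1) \<in> borel_measurable ?G"
    by (subst measurable_cong[of _ _ "\<phi> \<circ> Z (t - 1)"]) (auto simp: past_algebra_def Zhat)
  have sub_GF: "subalgebra ?G ?F"
    unfolding subalgebra_def
    using sets_image_in_sets[OF _ Zhat_G, of "space M"] by (simp add: past_algebra_def)
  interpret F: finite_measure_subalgebra M ?F by standard (rule sub_F)
  interpret G: finite_measure_subalgebra M ?G by standard (rule sub_G)
  let ?f = "indicat_real (Z t -` ?B \<inter> space M)"
  have "Z t -` ?B \<inter> space M \<in> sets M" using Z B by (rule measurable_sets)
  then have f_meas[measurable]: "?f \<in> borel_measurable M" and int_f: "integrable M ?f"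
    by (auto intro: borel_measurable_indicator integrable_real_indicator simp: less_top[symmetric])
  have "Zhat (t - 1) \<in> borel_measurable ?F"
    by (rule measurable_vimage_algebra1) simp
  then have "(\<lambda>\<omega>. H (p t) A (\<psi> (Zhat (t - 1) \<omega>))) \<in> borel_measurable ?F"
    using H_meas by measurable
  then have HZ_F: "(\<lambda>\<omega>. H (p t) A (Z (t - 1) \<omega>)) \<in> borel_measurable ?F"
    by (subst measurable_cong[of _ _ "\<lambda>\<omega>. H (p t) A (\<psi> (Zhat (t - 1) \<omega>))"]) (auto simp: Zhat \<psi>(2))
  have HZ_M: "(\<lambda>\<omega>. H (p t) A (Z (t - 1) \<omega>)) \<in> borel_measurable M"
    using H_meas by measurable
  have "integrable M (real_cond_exp M ?G ?f)" using int_f by (rule G.real_cond_exp_int)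
  then have HZ_int: "integrable M (\<lambda>\<omega>. H (p t) A (Z (t - 1) \<omega>))"
    using trans HZ_M by (subst integrable_cong_AE[of _ _ "real_cond_exp M ?G ?f"]) (auto elim: eventually_mono)
  \<comment> \<open>Tower property: \<open>H\<close> is its own conditional expectation given
    \<open>?F\<close>, hence that of \<open>real_cond_exp M ?G ?f\<close>, hence by nesting that of
    the box indicator, which \<open>factor\<close> turns into the product.\<close>
  have "AE \<omega> in M. real_cond_exp M ?F (\<lambda>\<omega>. H (p t) A (Z (t - 1) \<omega>)) \<omega> = H (p t) A (Z (t - 1) \<omega>)"
    using HZ_int HZ_F by (rule F.real_cond_exp_F_meas)
  moreover have "AE \<omega> in M. real_cond_exp M ?F (real_cond_exp M ?G ?f) \<omega> =
      real_cond_exp M ?F (\<lambda>\<omega>. H (p t) A (Z (t - 1) \<omega>)) \<omega>"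
    using trans HZ_M by (intro F.real_cond_exp_cong) auto
  moreover have "AE \<omega> in M. real_cond_exp M ?F (real_cond_exp M ?G ?f) \<omega> = real_cond_exp M ?F ?f \<omega>"
    using sub_G sub_GF int_f by (rule F.real_cond_exp_nested_subalg)
  moreover have "AE \<omega> in M. real_cond_exp M ?F (\<lambda>\<omega>. \<Prod>k\<in>UNIV. indicator (A k) (Zhat t \<omega> $ k)) \<omega> = real_cond_exp M ?F ?f \<omega>"
  proof (rule F.real_cond_exp_cong)
    have "(\<Prod>k\<in>UNIV. indicat_real (A k) (Zhat t \<omega> $ k)) = ?f \<omega>" if "\<omega> \<in> space M" for \<omega>
      using that by (auto simp: indicator_def Zhat)
    then show "AE \<omega> in M. (\<Prod>k\<in>UNIV. indicat_real (A k) (Zhat t \<omega> $ k)) = ?f \<omega>" by auto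
    show "(\<lambda>\<omega>. \<Prod>k\<in>UNIV. indicat_real (A k) (Zhat t \<omega> $ k)) \<in> borel_measurable M"
      using A by (intro borel_measurable_prod measurable_compose[OF borel_measurable_vec_nth[OF Zhat_meas]]) simp
  qed (rule f_meas)
  ultimately show "AE \<omega> in M. H (p t) A (Z (t - 1) \<omega>) =
    (\<Prod>k\<in>UNIV. real_cond_exp M ?F (\<lambda>\<omega>. indicator (A k) (Zhat t \<omega> $ k)) \<omega>)"
    using factor by eventually_elim simp
qed

text \<open>In each coordinate both sides multiply the same two factors.\<close>

lemma prod_fun_upd2_cross:
  fixes e :: "'n::finite \<Rightarrow> 'c \<Rightarrow> 'd::comm_monoid_mult"
  assumes "i \<noteq> j"
  shows "(\<Prod>k\<in>UNIV. e k (A k)) * (\<Prod>k\<in>UNIV. e k ((A(i := a, j := b)) k)) =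
    (\<Prod>k\<in>UNIV. e k ((A(i := a)) k)) * (\<Prod>k\<in>UNIV. e k ((A(j := b)) k))"
  unfolding prod.distrib[symmetric] using assms by (intro prod.cong) (auto simp: mult.commute)

text \<open>The conditional factors of \<open>lag_one_transition_AE\<close> are unknown functions of
  the outcome, but they occur equally on both sides, which leaves a relation for \<open>H\<close>
  alone. It holds for almost all values of \<open>Z (t - 1)\<close>, hence Lebesgue almost
  everywhere because the density \<open>q\<close> is positive.\<close>

lemma lag_one_transition_cross:
  fixes Z Zhat :: "nat \<Rightarrow> 'a \<Rightarrow> real ^ 'n" and \<phi> \<psi> :: "real ^ 'n \<Rightarrow> real ^ 'n"
  defines "H \<equiv> \<lambda>p A y. LINT z:{z. \<forall>k. \<phi> z $ k \<in> A k}|lborel. (\<Prod>k\<in>UNIV. p k (z $ k) y)"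
  assumes process: "lag_one_process M Z p" and t: "0 < t"
    and \<phi>: "\<phi> \<in> borel_measurable borel" and \<psi>: "\<psi> \<in> borel_measurable borel" "\<And>z. \<psi> (\<phi> z) = z"
    and Zhat: "\<And>s \<omega>. \<omega> \<in> space M \<Longrightarrow> Zhat s \<omega> = \<phi> (Z s \<omega>)"
    and indep: "cond_indep_components M (vimage_algebra (space M) (Zhat (t - 1)) borel) (Zhat t)"
    and q: "\<And>y. 0 < q y" "distributed M lborel (Z (t - 1)) (\<lambda>y. ennreal (q y))"
    and A: "\<And>k. A k \<in> sets borel" "a \<in> sets borel" "b \<in> sets borel" and ij: "i \<noteq> j"
  shows "AE y in lborel. H (p t) A y * H (p t) (A(i := a, j := b)) y =
     H (p t) (A(i := a)) y * H (p t) (A(j := b)) y"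
proof -
  let ?F = "vimage_algebra (space M) (Zhat (t - 1)) borel"
  have tr: "AE \<omega> in M. H (p t) A (Z (t - 1) \<omega>) =
      (\<Prod>k\<in>UNIV. real_cond_exp M ?F (\<lambda>\<omega>. indicator (A k) (Zhat t \<omega> $ k)) \<omega>)"
      "H (p t) A \<in> borel_measurable borel" if "\<And>k. A k \<in> sets borel" for A :: "'n \<Rightarrow> real set"
    unfolding H_def
  proof -
    show "AE \<omega> in M. (LBINT z:{z. \<forall>k. \<phi> z $ k \<in> A k}. \<Prod>k\<in>UNIV. p t k (z $ k) (Z (t - 1) \<omega>)) =
        (\<Prod>k\<in>UNIV. real_cond_exp M ?F (\<lambda>\<omega>. indicator (A k) (Zhat t \<omega> $ k)) \<omega>)"
      by (rule lag_one_transition_AE(1)[OF process t \<phi> \<psi> _ indep that]) (rule Zhat)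
    show "(\<lambda>y. LBINT z:{z. \<forall>k. \<phi> z $ k \<in> A k}. \<Prod>k\<in>UNIV. p t k (z $ k) y) \<in> borel_measurable borel"
      by (rule lag_one_transition_AE(2)[OF process t \<phi> \<psi> _ indep that]) (rule Zhat)
  qed
  have sets: "(A(i := a)) k \<in> sets borel" "(A(j := b)) k \<in> sets borel"
    "(A(i := a, j := b)) k \<in> sets borel" for k using A by auto
  note [measurable] = tr(2)[of A, OF A(1)] tr(2)[of "A(i := a)", OF sets(1)]
    tr(2)[of "A(j := b)", OF sets(2)] tr(2)[of "A(i := a, j := b)", OF sets(3)]
  have "AE \<omega> in M. H (p t) A (Z (t - 1) \<omega>) * H (p t) (A(i := a, j := b)) (Z (t - 1) \<omega>) =
     H (p t) (A(i := a)) (Z (t - 1) \<omega>) * H (p t) (A(j := b)) (Z (t - 1) \<omega>)"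
    using tr(1)[of A, OF A(1)] tr(1)[of "A(i := a)", OF sets(1)]
      tr(1)[of "A(j := b)", OF sets(2)] tr(1)[of "A(i := a, j := b)", OF sets(3)]
    by eventually_elim (simp only: prod_fun_upd2_cross[OF ij, of "\<lambda>k B. real_cond_exp M ?F (\<lambda>\<omega>. indicator B (Zhat t \<omega> $ k)) _"])
  then have "AE y in distr M lborel (Z (t - 1)). H (p t) A y * H (p t) (A(i := a, j := b)) y =
      H (p t) (A(i := a)) y * H (p t) (A(j := b)) y"
    using q(2) by (subst AE_distr_iff) (auto simp: distributed_def)
  then have "AE y in lborel. 0 < ennreal (q y) \<longrightarrow>
     H (p t) A y * H (p t) (A(i := a, j := b)) y = H (p t) (A(i := a)) y * H (p t) (A(j := b)) y"
    using q(2) by (simp only: distributed_distr_eq_density[OF q(2)])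
      (subst (asm) AE_density, auto simp: distributed_def)
  then show ?thesis using q(1) by simp
qed

section \<open>Shrinking preimages of boxes and cross ratios of densities\<close>

definition box_preimage :: "(real ^ 'n \<Rightarrow> real ^ 'n) \<Rightarrow> nat \<Rightarrow> real ^ 'n \<Rightarrow> (real ^ 'n) set" where
  "box_preimage \<phi> n w = {z. \<forall>k. \<phi> z $ k \<in> ball (w $ k) (1 / Suc n)}"

lemma open_box_preimage:
  assumes "continuous_on UNIV \<phi>"
  shows "open (box_preimage \<phi> n w)"
proof -
  have "open ((\<lambda>z. \<phi> z $ k) -` ball (w $ k) (1 / Suc n))" for k
    by (intro open_vimage open_ball continuous_on_component assms)
  then have "open (\<Inter>k. (\<lambda>z. \<phi> z $ k) -` ball (w $ k) (1 / Suc n))" by (intro open_INT) auto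
  moreover have "(\<Inter>k. (\<lambda>z. \<phi> z $ k) -` ball (w $ k) (1 / Suc n)) = box_preimage \<phi> n w"
    by (auto simp: box_preimage_def)
  ultimately show ?thesis by simp
qed

lemma box_preimage_shrinks:
  fixes \<phi> \<psi> :: "real ^ 'n \<Rightarrow> real ^ 'n"
  assumes "\<And>z. \<psi> (\<phi> z) = z" "isCont \<psi> w" "0 < e"
  shows "\<forall>\<^sub>F n in sequentially. box_preimage \<phi> n w \<subseteq> ball (\<psi> w) e"
proof -
  obtain d where d: "0 < d" "\<And>x. dist x w < d \<Longrightarrow> dist (\<psi> x) (\<psi> w) < e"
    using assms(2,3) unfolding continuous_at_eps_delta by blast
  \<comment> \<open>The factor \<open>CARD('n)\<close> comes from bounding the Euclidean norm by the
    sum of the absolute coordinates, each below \<open>1 / Suc n\<close> on the box.\<close>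
  have "(\<lambda>n. real CARD('n) * (1 / real (Suc n))) \<longlonglongrightarrow> real CARD('n) * 0"
    by (intro tendsto_intros LIMSEQ_Suc[OF lim_1_over_n])
  then have "\<forall>\<^sub>F n in sequentially. real CARD('n) * (1 / real (Suc n)) < d"
    using d(1) by (intro order_tendstoD(2)) auto
  then show ?thesis
  proof eventually_elim
    case (elim n)
    have "dist (\<psi> w) z < e" if z: "\<forall>k. \<phi> z $ k \<in> ball (w $ k) (1 / Suc n)" for z
    proof -
      have "dist (\<phi> z) w \<le> (\<Sum>k\<in>UNIV. \<bar>(\<phi> z - w) $ k\<bar>)"
        unfolding dist_norm by (rule norm_le_l1_cart)
      also have "\<dots> \<le> (\<Sum>k\<in>(UNIV :: 'n set). 1 / Suc n)"
        using z by (intro sum_mono) (simp add: dist_real_def abs_minus_commute less_imp_le)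
      also have "\<dots> < d" using elim by simp
      finally have "dist (\<psi> (\<phi> z)) (\<psi> w) < e" by (rule d(2))
      then show ?thesis by (simp add: assms(1) dist_commute)
    qed
    then show ?case by (auto simp: box_preimage_def)
  qed
qed

text \<open>The limit is expressed through Lebesgue measure alone, so it is shared by all densities
  \<open>f\<close> to which the lemma applies.\<close>

lemma cross_ratio_limit:
  fixes f :: "real ^ 'n \<Rightarrow> real" and \<phi> \<psi> :: "real ^ 'n \<Rightarrow> real ^ 'n" and w :: "bool \<Rightarrow> bool \<Rightarrow> real ^ 'n"
  defines "\<kappa> \<equiv> \<lambda>n a b. measure lborel (box_preimage \<phi> n (w a b))"
  assumes f: "continuous_on UNIV f" "\<And>z. 0 < f z"
    and \<phi>: "continuous_on UNIV \<phi>" and \<psi>: "\<And>z. \<psi> (\<phi> z) = z"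
    and w: "\<And>a b. \<phi> (\<psi> (w a b)) = w a b" "\<And>a b. isCont \<psi> (w a b)"
    and cross: "\<And>n. (LINT z:box_preimage \<phi> n (w False False)|lborel. f z) *
        (LINT z:box_preimage \<phi> n (w True True)|lborel. f z) =
        (LINT z:box_preimage \<phi> n (w True False)|lborel. f z) *
        (LINT z:box_preimage \<phi> n (w False True)|lborel. f z)"
  shows "(\<lambda>n. (\<kappa> n True False * \<kappa> n False True) / (\<kappa> n False False * \<kappa> n True True)) \<longlonglongrightarrow>
    (f (\<psi> (w False False)) * f (\<psi> (w True True))) / (f (\<psi> (w True False)) * f (\<psi> (w False True)))"
proof -
  define I where "I n a b = (LINT z:box_preimage \<phi> n (w a b)|lborel. f z)" for n a b
  have mem: "\<psi> (w a b) \<in> box_preimage \<phi> n (w a b)" for n a b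
    by (simp add: box_preimage_def w(1))
  note avg = shrinking_averages_tendsto[OF f(1) open_box_preimage[OF \<phi>] mem
      box_preimage_shrinks[OF \<psi> w(2)]]
  have lim: "(\<lambda>n. I n a b / \<kappa> n a b) \<longlonglongrightarrow> f (\<psi> (w a b))" for a b
    unfolding I_def \<kappa>_def by (rule avg(1))
  have \<kappa>_pos: "\<forall>\<^sub>F n in sequentially. 0 < \<kappa> n a b" for a b
    unfolding \<kappa>_def by (rule avg(2))
  have ratio_pos: "\<forall>\<^sub>F n in sequentially. 0 < I n a b / \<kappa> n a b" for a b
    using lim f(2) by (rule order_tendstoD(1))
  \<comment> \<open>By \<open>cross\<close> the masses \<open>I\<close> cancel, the two in the
    denominator being eventually positive, and only the Lebesgue measures remain.\<close>
  have "\<forall>\<^sub>F n in sequentially.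
     (I n False False / \<kappa> n False False * (I n True True / \<kappa> n True True)) /
     (I n True False / \<kappa> n True False * (I n False True / \<kappa> n False True)) =
     (\<kappa> n True False * \<kappa> n False True) / (\<kappa> n False False * \<kappa> n True True)"
    using \<kappa>_pos[of False False] \<kappa>_pos[of True True] \<kappa>_pos[of True False] \<kappa>_pos[of False True]
      ratio_pos[of True False] ratio_pos[of False True]
  proof eventually_elim
    case (elim n)
    then have "0 < I n True False" "0 < I n False True" by (simp_all add: zero_less_divide_iff)
    then show ?case using elim(1-4) cross[of n] by (simp add: I_def[symmetric] field_simps)
  qed
  moreover have "(\<lambda>n. (I n False False / \<kappa> n False False * (I n True True / \<kappa> n True True)) /
     (I n True False / \<kappa> n True False * (I n False True / \<kappa> n False True))) \<longlonglongrightarrow>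
    (f (\<psi> (w False False)) * f (\<psi> (w True True))) / (f (\<psi> (w True False)) * f (\<psi> (w False True)))"
    using f(2) by (intro tendsto_divide tendsto_mult lim) (simp add: less_imp_neq[symmetric])
  ultimately show ?thesis by (rule Lim_transform_eventually[rotated])
qed

text \<open>The flags select a vertex of the rectangle at \<open>c\<close> with sides
  \<open>a\<close>, \<open>b\<close> along the axes \<open>i\<close>, \<open>j\<close>, so that one
  statement can quantify over all four vertices.\<close>

definition corner :: "real ^ 'n \<Rightarrow> 'n \<Rightarrow> 'n \<Rightarrow> real \<Rightarrow> real \<Rightarrow> bool \<Rightarrow> bool \<Rightarrow> real ^ 'n" where
  "corner c i j a b s s' =
     c + (if s then a else 0) *\<^sub>R axis i 1 + (if s' then b else 0) *\<^sub>R axis j 1"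

text \<open>Moving a corner along an axis changes only the interval of that axis; this brings the
  boxes into the updated form of \<open>lag_one_transition_cross\<close>.\<close>

lemma box_preimage_corner:
  fixes c :: "real ^ 'n"
  assumes "i \<noteq> j"
  defines "A \<equiv> \<lambda>n k. ball (c $ k) (1 / Suc n)"
  shows "box_preimage \<phi> n (corner c i j a b False False) = {z. \<forall>k. \<phi> z $ k \<in> A n k}"
    "box_preimage \<phi> n (corner c i j a b True False) =
       {z. \<forall>k. \<phi> z $ k \<in> ((A n)(i := ball (c $ i + a) (1 / Suc n))) k}"
    "box_preimage \<phi> n (corner c i j a b False True) =
       {z. \<forall>k. \<phi> z $ k \<in> ((A n)(j := ball (c $ j + b) (1 / Suc n))) k}"
    "box_preimage \<phi> n (corner c i j a b True True) =
       {z. \<forall>k. \<phi> z $ k \<in> ((A n)(i := ball (c $ i + a) (1 / Suc n),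
          j := ball (c $ j + b) (1 / Suc n))) k}"
  using assms(1) unfolding box_preimage_def corner_def A_def
  by (auto simp: axis_def set_eq_iff split: if_splits)

text \<open>The sequence contains neither \<open>p\<close> nor \<open>y\<close>, so it is literally
  the same in all contexts; this later identifies the limits with each other. The corners are fixed
  before the null set of \<open>y\<close> is chosen.\<close>

lemma lag_one_cross_ratio_limit:
  fixes Z Zhat :: "nat \<Rightarrow> 'a \<Rightarrow> real ^ 'n" and \<phi> \<psi> :: "real ^ 'n \<Rightarrow> real ^ 'n"
  defines "\<kappa> \<equiv> \<lambda>c i j a b n s s'. measure lborel (box_preimage \<phi> n (corner c i j a b s s'))"
    and "f \<equiv> \<lambda>p y z. \<Prod>k\<in>UNIV. p k (z $ k) y"
  assumes process: "lag_one_process M Z p" and t: "0 < t"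
    and \<phi>: "continuous_on UNIV \<phi>" and \<psi>: "\<psi> \<in> borel_measurable borel" "\<And>z. \<psi> (\<phi> z) = z"
    and Zhat: "\<And>s \<omega>. \<omega> \<in> space M \<Longrightarrow> Zhat s \<omega> = \<phi> (Z s \<omega>)"
    and indep: "cond_indep_components M (vimage_algebra (space M) (Zhat (t - 1)) borel) (Zhat t)"
    and q: "\<And>y. 0 < q y" "distributed M lborel (Z (t - 1)) (\<lambda>y. ennreal (q y))"
    and p: "\<And>k x y. 0 < p t k x y" "\<And>k y. continuous_on UNIV (\<lambda>x. p t k x y)"
    and w: "\<And>s s'. \<phi> (\<psi> (corner c i j a b s s')) = corner c i j a b s s'"
      "\<And>s s'. isCont \<psi> (corner c i j a b s s')"
    and ij: "i \<noteq> j"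
  shows "AE y in lborel. (\<lambda>n. (\<kappa> c i j a b n True False * \<kappa> c i j a b n False True) /
      (\<kappa> c i j a b n False False * \<kappa> c i j a b n True True)) \<longlonglongrightarrow>
    (f (p t) y (\<psi> (corner c i j a b False False)) * f (p t) y (\<psi> (corner c i j a b True True))) /
    (f (p t) y (\<psi> (corner c i j a b True False)) * f (p t) y (\<psi> (corner c i j a b False True)))"
proof -
  let ?w = "corner c i j a b"
  have \<phi>_meas: "\<phi> \<in> borel_measurable borel" using \<phi> by (rule borel_measurable_continuous_onI)
  have "AE y in lborel.
      (LINT z:box_preimage \<phi> n (?w False False)|lborel. f (p t) y z) *
        (LINT z:box_preimage \<phi> n (?w True True)|lborel. f (p t) y z) =
        (LINT z:box_preimage \<phi> n (?w True False)|lborel. f (p t) y z) *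
        (LINT z:box_preimage \<phi> n (?w False True)|lborel. f (p t) y z)" for n
    unfolding box_preimage_corner[OF ij] f_def
    by (rule lag_one_transition_cross[OF process t \<phi>_meas \<psi> _ indep q _ _ _ ij]) (auto simp: Zhat)
  \<comment> \<open>There are countably many box sizes, so one null set serves them all.\<close>
  then have "AE y in lborel. \<forall>n.
      (LINT z:box_preimage \<phi> n (?w False False)|lborel. f (p t) y z) *
        (LINT z:box_preimage \<phi> n (?w True True)|lborel. f (p t) y z) =
        (LINT z:box_preimage \<phi> n (?w True False)|lborel. f (p t) y z) *
        (LINT z:box_preimage \<phi> n (?w False True)|lborel. f (p t) y z)"
    by (subst AE_all_countable) simp
  then show ?thesis
  proof eventually_elim
    case (elim y)
    have "continuous_on UNIV (\<lambda>z :: real ^ 'n. p t k (z $ k) y)" for k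
      by (rule continuous_on_compose2[OF p(2)]) (auto intro: continuous_intros)
    then have cont: "continuous_on UNIV (f (p t) y)"
      unfolding f_def by (intro continuous_on_prod)
    have pos: "0 < f (p t) y z" for z unfolding f_def using p(1) by (simp add: prod_pos)
    show ?case
      unfolding \<kappa>_def by (rule cross_ratio_limit[OF cont pos \<phi> \<psi>(2) w]) (use elim in auto)
  qed
qed

subsection \<open>Derivatives of component-wise sums and monomial Jacobians\<close>

lemma has_real_derivative_along_line:
  fixes f :: "'a::real_normed_vector \<Rightarrow> real ^ 'n"
  assumes "f differentiable (at (x + s *\<^sub>R v))"
  shows "((\<lambda>a. f (x + a *\<^sub>R v) $ k) has_real_derivative
      frechet_derivative f (at (x + s *\<^sub>R v)) v $ k) (at s)"
proof -
  let ?D = "frechet_derivative f (at (x + s *\<^sub>R v))"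
  have D: "(f has_derivative ?D) (at (x + s *\<^sub>R v))"
    using assms by (simp add: frechet_derivative_works)
  have "((\<lambda>a. x + a *\<^sub>R v) has_derivative (\<lambda>a. a *\<^sub>R v)) (at s)"
    by (auto intro!: derivative_eq_intros)
  from has_derivative_compose[OF this D]
  have "((\<lambda>a. f (x + a *\<^sub>R v)) has_derivative (\<lambda>a. ?D (a *\<^sub>R v))) (at s)" .
  then have "((\<lambda>a. f (x + a *\<^sub>R v) $ k) has_derivative (\<lambda>a. ?D (a *\<^sub>R v) $ k)) (at s)"
    by (rule bounded_linear.has_derivative[OF bounded_linear_vec_nth])
  moreover have "?D (a *\<^sub>R v) $ k = ?D v $ k * a" for a
    using linear_cmul[OF has_derivative_linear[OF D], of a v] by simp
  ultimately show ?thesis by (simp add: has_field_derivative_def)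
qed

lemma DERIV_locally_const_imp_zero:
  fixes f :: "real \<Rightarrow> real"
  assumes "(f has_real_derivative D) (at x)" "0 < \<delta>" "\<And>a. \<bar>a - x\<bar> < \<delta> \<Longrightarrow> f a = f x"
  shows "D = 0"
proof -
  have "\<forall>\<^sub>F a in nhds x. f a = f x"
    unfolding eventually_nhds_metric dist_real_def using assms(2,3) by blast
  then have "((\<lambda>_. f x) has_real_derivative D) (at x)"
    using assms(1) by (rule DERIV_cong_ev[OF refl _ refl, THEN iffD1])
  then show ?thesis by (rule DERIV_unique) simp
qed

text \<open>Differentiate the vanishing alternating sum at 0, first in \<open>a\<close>, then in
  \<open>b\<close>. All derivatives are taken along lines, so two derivatives of \<open>F k\<close>
  suffice, without continuity of \<open>F''\<close>. The chain and product rules pair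
  \<open>F''\<close> with a product of first partials of \<open>h\<close>, and \<open>F'\<close>
  with a mixed second partial.\<close>

lemma vanishing_cross_difference_imp:
  fixes h :: "real ^ 'n \<Rightarrow> real ^ 'n" and F F' F'' :: "'n \<Rightarrow> real \<Rightarrow> real"
  defines "G \<equiv> \<lambda>x. \<Sum>k\<in>UNIV. F k (h x $ k)"
    and "dh \<equiv> \<lambda>i x. frechet_derivative h (at x) (axis i 1)"
  assumes U: "open U" "c \<in> U" and h: "Ck_on 2 h U"
    and F: "\<And>k x. (F k has_real_derivative F' k x) (at x)"
    and F': "\<And>k x. (F' k has_real_derivative F'' k x) (at x)"
    and cross: "\<And>a b. c + a *\<^sub>R axis i 1 \<in> U \<Longrightarrow> c + b *\<^sub>R axis j 1 \<in> U \<Longrightarrow>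
        c + a *\<^sub>R axis i 1 + b *\<^sub>R axis j 1 \<in> U \<Longrightarrow>
        G c + G (c + a *\<^sub>R axis i 1 + b *\<^sub>R axis j 1) =
        G (c + a *\<^sub>R axis i 1) + G (c + b *\<^sub>R axis j 1)"
  shows "(\<Sum>k\<in>UNIV. F'' k (h c $ k) * (dh i c $ k * dh j c $ k) +
      F' k (h c $ k) * frechet_derivative (dh i) (at c) (axis j 1) $ k) = 0"
proof -
  define e where "e i = (axis i 1 :: real ^ 'n)" for i
  have norm_e: "norm (e i) = 1" for i by (simp add: e_def)
  have h1: "h differentiable (at x)" if "x \<in> U" for x
    using h that by (simp add: numeral_2_eq_2)
  have h2: "dh i differentiable (at x)" if "x \<in> U" for x
    using h that by (simp add: numeral_2_eq_2 dh_def)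
  \<comment> \<open>Halving the radius keeps the far corner in \<open>U\<close> when both side
    lengths are below \<open>\<delta>\<close>.\<close>
  obtain \<delta> where \<delta>: "0 < \<delta>" "ball c (2 * \<delta>) \<subseteq> U"
  proof -
    obtain \<epsilon> where "0 < \<epsilon>" "ball c \<epsilon> \<subseteq> U" using U open_contains_ball by blast
    then show ?thesis using that[of "\<epsilon> / 2"] by simp
  qed
  have in_U: "c + a *\<^sub>R e i + b *\<^sub>R e j \<in> U" if "\<bar>a\<bar> < \<delta>" "\<bar>b\<bar> < \<delta>" for a b
  proof -
    have "norm (a *\<^sub>R e i + b *\<^sub>R e j) \<le> \<bar>a\<bar> + \<bar>b\<bar>"
      by (rule norm_triangle_le) (simp add: norm_e)
    moreover have "dist c (c + a *\<^sub>R e i + b *\<^sub>R e j) = norm (a *\<^sub>R e i + b *\<^sub>R e j)"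
      by (metis add.assoc add_diff_cancel_left' dist_commute dist_norm)
    ultimately have "c + a *\<^sub>R e i + b *\<^sub>R e j \<in> ball c (2 * \<delta>)"
      using that by simp
    then show ?thesis using \<delta>(2) by blast
  qed
  define D where "D x = (\<Sum>k\<in>UNIV. F' k (h x $ k) * dh i x $ k)" for x
  have D: "((\<lambda>a. G (x + a *\<^sub>R e i)) has_real_derivative D x) (at 0)" if "x \<in> U" for x
  proof -
    have "((\<lambda>a. F k (h (x + a *\<^sub>R e i) $ k)) has_real_derivative F' k (h x $ k) * dh i x $ k) (at 0)" for k
      using DERIV_chain2[OF F has_real_derivative_along_line[of h x 0 "e i" k]] h1[OF that]
      by (simp add: dh_def e_def)
    then show ?thesis unfolding G_def D_def by (intro DERIV_sum)
  qed
  \<comment> \<open>By \<open>cross\<close>, the increments of \<open>G\<close> in direction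
    \<open>i\<close> from \<open>c\<close> and from \<open>c + b *\<^sub>R e j\<close> agree, hence
    so do their derivatives \<open>D\<close>.\<close>
  have D_const: "D (c + b *\<^sub>R e j) = D c" if b: "\<bar>b\<bar> < \<delta>" for b
  proof -
    have "c \<in> U" "c + b *\<^sub>R e j \<in> U" using in_U[of 0 0] in_U[of 0 b] b \<delta>(1) by auto
    then have "((\<lambda>a. G (c + b *\<^sub>R e j + a *\<^sub>R e i) - G (c + a *\<^sub>R e i)) has_real_derivative
        D (c + b *\<^sub>R e j) - D c) (at 0)"
      by (intro DERIV_diff D)
    then have "D (c + b *\<^sub>R e j) - D c = 0"
    proof (rule DERIV_locally_const_imp_zero[OF _ \<delta>(1)])
      fix a :: real assume a: "\<bar>a - 0\<bar> < \<delta>"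
      have "c + a *\<^sub>R axis i 1 \<in> U" "c + b *\<^sub>R axis j 1 \<in> U" "c + a *\<^sub>R axis i 1 + b *\<^sub>R axis j 1 \<in> U"
        using in_U[of a 0] in_U[of 0 b] in_U[of a b] a b \<delta>(1) by (auto simp: e_def)
      from cross[OF this] show "G (c + b *\<^sub>R e j + a *\<^sub>R e i) - G (c + a *\<^sub>R e i) =
          G (c + b *\<^sub>R e j + 0 *\<^sub>R e i) - G (c + 0 *\<^sub>R e i)"
        by (simp add: e_def algebra_simps)
    qed
    then show ?thesis by simp
  qed
  let ?E = "\<lambda>k. F'' k (h c $ k) * (dh i c $ k * dh j c $ k) +
      F' k (h c $ k) * frechet_derivative (dh i) (at c) (axis j 1) $ k"
  have "((\<lambda>b. F' k (h (c + b *\<^sub>R e j) $ k) * dh i (c + b *\<^sub>R e j) $ k) has_real_derivative ?E k) (at 0)" for k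
  proof -
    have "((\<lambda>b. F' k (h (c + b *\<^sub>R e j) $ k)) has_real_derivative F'' k (h c $ k) * dh j c $ k) (at 0)"
      using DERIV_chain2[OF F' has_real_derivative_along_line[of h c 0 "e j" k]] h1[OF U(2)]
      by (simp add: dh_def e_def)
    moreover have "((\<lambda>b. dh i (c + b *\<^sub>R e j) $ k) has_real_derivative
        frechet_derivative (dh i) (at c) (axis j 1) $ k) (at 0)"
      using has_real_derivative_along_line[of "dh i" c 0 "e j" k] h2[OF U(2)] by (simp add: e_def)
    ultimately show ?thesis
      by (rule DERIV_cong[OF DERIV_mult]) (simp add: algebra_simps)
  qed
  then have "((\<lambda>b. D (c + b *\<^sub>R e j)) has_real_derivative (\<Sum>k\<in>UNIV. ?E k)) (at 0)"
    unfolding D_def by (intro DERIV_sum)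
  then show ?thesis
    by (rule DERIV_locally_const_imp_zero[OF _ \<delta>(1)]) (simp add: D_const)
qed

text \<open>Each row of \<open>J\<close> has at most one nonzero entry by \<open>rows\<close>, and
  at least one since \<open>J\<close> is onto. With \<open>\<sigma> k\<close> its column, row
  \<open>k\<close> of the identity \<open>J (K v) = v\<close> determines row
  \<open>\<sigma> k\<close> of \<open>K\<close>: its only nonzero entry is in column
  \<open>k\<close>. So \<open>K\<close> is supported on the inverse of
  \<open>\<sigma>\<close>.\<close>

lemma linear_inverse_of_monomial_rows:
  fixes J K :: "real ^ 'n \<Rightarrow> real ^ 'n"
  assumes lin: "linear J" and JK: "\<And>v. J (K v) = v"
    and rows: "\<And>k i j. i \<noteq> j \<Longrightarrow> J (axis i 1) $ k * J (axis j 1) $ k = 0"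
  obtains \<pi> where "\<pi> permutes UNIV" "\<And>i l. K (axis l 1) $ i \<noteq> 0 \<longleftrightarrow> l = \<pi> i"
proof -
  have J_sum: "J v $ k = (\<Sum>l\<in>UNIV. v $ l * J (axis l 1) $ k)" for v k
  proof -
    have "J v = J (\<Sum>l\<in>UNIV. v $ l *\<^sub>R axis l 1)"
      using basis_expansion[of v] by (simp add: scalar_mult_eq_scaleR)
    also have "\<dots> = (\<Sum>l\<in>UNIV. v $ l *\<^sub>R J (axis l 1))"
      using lin by (simp add: linear_sum linear_cmul)
    finally show ?thesis by simp
  qed
  have "\<exists>i. J (axis i 1) $ k \<noteq> 0" for k
  proof (rule ccontr)
    assume "\<not> ?thesis"
    then have "J (K (axis k 1)) $ k = 0" by (subst J_sum) simp
    then show False by (simp add: JK)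
  qed
  then obtain \<sigma> where \<sigma>: "\<And>k. J (axis (\<sigma> k) 1) $ k \<noteq> 0" by metis
  have K: "K (axis m 1) $ \<sigma> k \<noteq> 0 \<longleftrightarrow> m = k" for m k
  proof -
    have "J (K (axis m 1)) $ k = K (axis m 1) $ \<sigma> k * J (axis (\<sigma> k) 1) $ k"
    proof -
      have "K (axis m 1) $ l * J (axis l 1) $ k = 0" if "l \<noteq> \<sigma> k" for l
        using rows[OF that, of k] \<sigma>[of k] by simp
      then have "(\<Sum>l\<in>UNIV - {\<sigma> k}. K (axis m 1) $ l * J (axis l 1) $ k) = 0"
        by (intro sum.neutral) auto
      then show ?thesis by (simp add: J_sum[of "K (axis m 1)"] sum.remove[of UNIV "\<sigma> k"])
    qed
    then have "K (axis m 1) $ \<sigma> k * J (axis (\<sigma> k) 1) $ k = (axis m 1 :: real ^ 'n) $ k"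
      by (simp add: JK)
    then show ?thesis using \<sigma>[of k] by (auto simp: axis_def split: if_splits)
  qed
  then have "inj \<sigma>" by (intro injI) metis
  then have bij: "bij \<sigma>" by (simp add: bij_def finite_UNIV_inj_surj)
  show thesis
  proof (rule that[of "inv \<sigma>"])
    show "inv \<sigma> permutes UNIV" using bij by (intro bij_imp_permutes bij_imp_bij_inv) auto
    show "K (axis l 1) $ i \<noteq> 0 \<longleftrightarrow> l = inv \<sigma> i" for i l
      using K[of l "inv \<sigma> i"] bij by (simp add: bij_inv_eq_iff surj_f_inv_f bij_is_surj)
  qed
qed

text \<open>A nonzero entry of the derivative stays nonzero nearby, so its position in each row is
  locally constant, hence constant on the connected space. Component \<open>i\<close> then depends
  on coordinate \<open>\<pi> i\<close> only.\<close>

lemma monomial_derivative_imp_componentwise: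
  fixes \<phi> :: "real ^ 'n \<Rightarrow> real ^ 'n"
  assumes \<phi>: "Ck_on 1 \<phi> UNIV" "inj \<phi>"
    and mono: "\<And>z. \<exists>\<pi>. \<pi> permutes UNIV \<and>
        (\<forall>i l. frechet_derivative \<phi> (at z) (axis l 1) $ i \<noteq> 0 \<longleftrightarrow> l = \<pi> i)"
  obtains \<pi> T where "\<pi> permutes UNIV" "\<And>k. inj (T k)" "\<And>z k. \<phi> z $ k = T k (z $ \<pi> k)"
proof -
  let ?K = "\<lambda>z. frechet_derivative \<phi> (at z)"
  have diff: "\<phi> differentiable (at z)" and cont: "continuous_on UNIV (\<lambda>z. ?K z v)" for z v
    using \<phi>(1) by auto
  obtain P where P: "\<And>z. P z permutes UNIV" "\<And>z i l. ?K z (axis l 1) $ i \<noteq> 0 \<longleftrightarrow> l = P z i"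
    using mono by metis
  have P_const: "P z i = P 0 i" for z i
  proof -
    define Q where "Q z = P z i" for z
    have Q: "?K z (axis l 1) $ i \<noteq> 0 \<longleftrightarrow> l = Q z" for z l
      unfolding Q_def by (rule P(2))
    have "\<exists>T. openin (top_of_set UNIV) T \<and> z \<in> T \<and> (\<forall>x\<in>T. Q x = Q z)" for z
    proof (intro exI conjI ballI)
      let ?T = "{x. ?K x (axis (Q z) 1) $ i \<noteq> 0}"
      have "open ((\<lambda>x. ?K x (axis (Q z) 1) $ i) -` (- {0}))"
        by (intro open_vimage continuous_on_component cont) auto
      moreover have "(\<lambda>x. ?K x (axis (Q z) 1) $ i) -` (- {0}) = ?T" by auto
      ultimately show "openin (top_of_set UNIV) ?T" by simp
      show "z \<in> ?T" using Q[of z "Q z"] by simp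
      show "Q x = Q z" if "x \<in> ?T" for x using Q[of x "Q z"] that by simp
    qed
    then have "Q constant_on UNIV"
      by (rule locally_constant_imp_constant[OF connected_UNIV])
    then obtain c where "\<And>z. Q z = c" unfolding constant_on_def by blast
    then show ?thesis by (simp add: Q_def[symmetric])
  qed
  define \<pi> where "\<pi> = P 0"
  have \<pi>: "\<pi> permutes UNIV" using P(1) by (simp add: \<pi>_def)
  have K0: "?K z (axis l 1) $ i = 0" if "l \<noteq> \<pi> i" for z l i
    using P(2)[of z l i] P_const[of z i] that by (simp add: \<pi>_def)
  have dep: "\<phi> z $ i = \<phi> z' $ i" if eq: "z $ \<pi> i = z' $ \<pi> i" for z z' i
  proof -
    let ?v = "z' - z"
    \<comment> \<open>On the segment from \<open>z\<close> to \<open>z'\<close> coordinate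
      \<open>\<pi> i\<close> is fixed, and the partials in all other directions vanish.\<close>
    have "((\<lambda>s. \<phi> (z + s *\<^sub>R ?v) $ i) has_real_derivative 0) (at s)" for s
    proof -
      have lin: "linear (?K (z + s *\<^sub>R ?v))"
        using diff by (rule linear_frechet_derivative)
      have "?K (z + s *\<^sub>R ?v) ?v = ?K (z + s *\<^sub>R ?v) (\<Sum>l\<in>UNIV. ?v $ l *\<^sub>R axis l 1)"
        using basis_expansion[of ?v] by (simp add: scalar_mult_eq_scaleR)
      also have "\<dots> = (\<Sum>l\<in>UNIV. ?v $ l *\<^sub>R ?K (z + s *\<^sub>R ?v) (axis l 1))"
        by (simp only: linear_sum[OF lin] linear_cmul[OF lin])
      finally have "?K (z + s *\<^sub>R ?v) ?v $ i = (\<Sum>l\<in>UNIV. ?v $ l * ?K (z + s *\<^sub>R ?v) (axis l 1) $ i)"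
        by simp
      also have "\<dots> = 0"
      proof (intro sum.neutral ballI)
        fix l
        show "?v $ l * ?K (z + s *\<^sub>R ?v) (axis l 1) $ i = 0"
          using K0[of l i] eq by (cases "l = \<pi> i") auto
      qed
      finally show ?thesis
        using has_real_derivative_along_line[where x = z and s = s and v = ?v and k = i, OF diff] by simp
    qed
    from DERIV_isconst_all[OF allI[OF this], of 0 1] show ?thesis by simp
  qed
  \<comment> \<open>The diagonal is a convenient choice: by \<open>dep\<close>, any vector whose
    coordinate \<open>\<pi> k\<close> is \<open>x\<close> gives the same value.\<close>
  define T where "T k x = \<phi> (\<chi> j. x) $ k" for k x
  have T: "\<phi> z $ k = T k (z $ \<pi> k)" for z k
    unfolding T_def by (rule dep) simp
  have "inj (T k)" for k
  proof (rule injI)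
    fix a b assume ab: "T k a = T k b"
    \<comment> \<open>The two points may differ only in coordinate \<open>\<pi> k\<close>, which no
      component other than \<open>k\<close> sees, so equality of \<open>T k\<close> forces equal
      images under the injective \<open>\<phi>\<close>.\<close>
    let ?z = "(\<chi> j. a) :: real ^ 'n" and ?z' = "(\<chi> j. if j = \<pi> k then b else a) :: real ^ 'n"
    have "\<phi> ?z $ i = \<phi> ?z' $ i" for i
    proof (cases "i = k")
      case True
      then show ?thesis using ab by (simp add: T)
    next
      case False
      then have "\<pi> i \<noteq> \<pi> k" using permutes_inj[OF \<pi>] by (auto dest: injD)
      then show ?thesis by (simp add: T)
    qed
    then have "\<phi> ?z = \<phi> ?z'" by (simp only: vec_eq_iff) blast
    then have "?z = ?z'" by (rule injD[OF \<phi>(2)])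
    then have "?z $ \<pi> k = ?z' $ \<pi> k" by simp
    then show "a = b" by simp
  qed
  from that[OF \<pi> this T] show thesis .
qed

section \<open>Smoothness classes, partial derivatives and the inverse map\<close>

lemma Ck_on_Suc_imp: "Ck_on (Suc k) f S \<Longrightarrow> Ck_on k f S"
proof (induction k arbitrary: f)
  case 0
  then show ?case
    by (auto intro!: continuous_at_imp_continuous_on differentiable_imp_continuous_within)
qed auto

lemma Ck_on_mono: "Ck_on k f S \<Longrightarrow> l \<le> k \<Longrightarrow> Ck_on l f S"
  by (induction k) (auto simp: le_Suc_eq intro: Ck_on_Suc_imp simp del: Ck_on.simps)

lemma has_pd_cur_DERIV:
  assumes "has_pd_cur e"
  shows "((\<lambda>x. e x y) has_real_derivative pd_cur e x y) (at x)"
  using assms unfolding has_pd_cur_def pd_cur_def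
  by (simp add: DERIV_deriv_iff_real_differentiable)

lemma has_pd_prev_DERIV:
  assumes "has_pd_prev l e"
  shows "((\<lambda>a. e x (y + a *\<^sub>R axis l 1)) has_real_derivative pd_prev l e x y) (at 0)"
  using assms unfolding has_pd_prev_def pd_prev_def
  by (simp add: DERIV_deriv_iff_real_differentiable)

text \<open>Differentiability is given at parameter 0 but for every base point; recentring at
  \<open>y + b *\<^sub>R axis l 1\<close> carries it to parameter \<open>b\<close>.\<close>

lemma has_pd_prev_continuous_on:
  assumes "has_pd_prev l e"
  shows "continuous_on UNIV (\<lambda>a. e x (y + a *\<^sub>R axis l 1))"
proof (intro continuous_at_imp_continuous_on ballI)
  fix b
  let ?f = "\<lambda>a. e x ((y + b *\<^sub>R axis l 1) + a *\<^sub>R axis l 1)"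
  have "isCont ?f (b - b)"
    using DERIV_isCont[OF has_pd_prev_DERIV[OF assms]] by simp
  then have "isCont (\<lambda>a. ?f (a - b)) b"
    by (intro isCont_o2[where f = "\<lambda>a. a - b" and g = ?f]) auto
  then show "isCont (\<lambda>a. e x (y + a *\<^sub>R axis l 1)) b"
    by (simp add: algebra_simps)
qed

lemma latent_map_left_inverse:
  assumes "inj g" "inj_on ghat (range g)"
  shows "latent_map g ghat (ghat (g z)) = z"
  using assms by (simp add: latent_map_def inv_into_f_f)

lemma frechet_derivative_left_inverse:
  assumes "\<And>z. h (\<phi> z) = z" "\<phi> differentiable (at z)" "h differentiable (at (\<phi> z))"
  shows "frechet_derivative h (at (\<phi> z)) (frechet_derivative \<phi> (at z) v) = v"
proof -
  have "((\<lambda>z. h (\<phi> z)) has_derivative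
      (\<lambda>v. frechet_derivative h (at (\<phi> z)) (frechet_derivative \<phi> (at z) v))) (at z)"
    using assms(2,3) unfolding frechet_derivative_works by (rule has_derivative_compose)
  then have "((\<lambda>z. z) has_derivative
      (\<lambda>v. frechet_derivative h (at (\<phi> z)) (frechet_derivative \<phi> (at z) v))) (at z)"
    by (simp add: assms(1))
  from has_derivative_unique[OF this has_derivative_ident] show ?thesis by (rule fun_cong)
qed

subsection \<open>Identifiability\<close>

theorem theorem2:
  fixes m t :: nat
    and u :: "nat \<Rightarrow> 'u"
    and M :: "'u \<Rightarrow> 'a measure"
    and Z Zhat :: "'u \<Rightarrow> nat \<Rightarrow> 'a \<Rightarrow> real ^ 'n"
    and X :: "'u \<Rightarrow> nat \<Rightarrow> 'a \<Rightarrow> 'x"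
    and g :: "real ^ 'n \<Rightarrow> 'x"
    and ghat :: "'x \<Rightarrow> real ^ 'n"
    and p :: "'u \<Rightarrow> nat \<Rightarrow> 'n \<Rightarrow> real \<Rightarrow> real ^ 'n \<Rightarrow> real"
    and \<eta> :: "'n \<Rightarrow> nat \<Rightarrow> real \<Rightarrow> real ^ 'n \<Rightarrow> real"
  assumes m: "1 \<le> m" and t: "0 < t"
    and process: "\<And>r. r \<in> {1..m} \<Longrightarrow> lag_one_process (M (u r)) (Z (u r)) (p (u r))"
    and x_def: "\<And>r s \<omega>. r \<in> {1..m} \<Longrightarrow> \<omega> \<in> space (M (u r)) \<Longrightarrow> X (u r) s \<omega> = g (Z (u r) s \<omega>)"
    and zhat_def: "\<And>r s \<omega>. r \<in> {1..m} \<Longrightarrow> \<omega> \<in> space (M (u r)) \<Longrightarrow>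
          Zhat (u r) s \<omega> = ghat (X (u r) s \<omega>)"
    and g: "inj g" and ghat: "inj_on ghat (range g)"
    and indep_z: "\<And>r. r \<in> {1..m} \<Longrightarrow>
          cond_indep_components (M (u r))
            (vimage_algebra (space (M (u r))) (Z (u r) (t - 1)) borel) (Z (u r) t)"
    and indep_zhat: "\<And>r. r \<in> {1..m} \<Longrightarrow>
          cond_indep_components (M (u r))
            (vimage_algebra (space (M (u r))) (Zhat (u r) (t - 1)) borel) (Zhat (u r) t)"
    and prev_density: "\<And>r. r \<in> {1..m} \<Longrightarrow>
          \<exists>q :: real ^ 'n \<Rightarrow> real. (\<forall>y. 0 < q y) \<and>
            distributed (M (u r)) lborel (Z (u r) (t - 1)) (\<lambda>y. ennreal (q y))"
    and cond_density_pos: "\<And>r k x y. r \<in> {1..m} \<Longrightarrow> 0 < p (u r) t k x y"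
    and eta_def: "\<And>k r. r \<in> {1..m} \<Longrightarrow> \<eta> k r = log_density (p (u r) t k)"
    and partials: "\<And>k r. r \<in> {1..m} \<Longrightarrow> partials_exist (\<eta> k r)"
    and diffeo: "Ck_diffeomorphism 3 (latent_map g ghat) (ghat ` range g) UNIV"
    and lin_indep: "\<And>z :: real ^ 'n.
          lin_indep_functions (entries m :: ((nat \<times> 'n) + nat) set)
            (\<lambda>k y. s_vec (\<eta> k) (z $ k) y) (\<lambda>k y. s_ring_vec (\<eta> k) (z $ k) y)"
  shows "\<exists>(\<pi> :: 'n \<Rightarrow> 'n) (T :: 'n \<Rightarrow> real \<Rightarrow> real).
           \<pi> permutes UNIV \<and> (\<forall>k. inj (T k)) \<and>
           (\<forall>z k. ghat (g z) $ k = T k (z $ \<pi> k)) \<and>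
           (\<forall>r\<in>{1..m}. \<forall>\<omega>\<in>space (M (u r)). \<forall>k.
              Zhat (u r) t \<omega> $ k = T k (Z (u r) t \<omega> $ \<pi> k))"
proof -

  \<comment> \<open>The map \<open>\<phi>\<close> and its inverse\<close>
  define \<phi> where "\<phi> = ghat \<circ> g"
  define U where "U = ghat ` range g"
  define h where "h = latent_map g ghat"
  \<comment> \<open>The value 0 off \<open>U\<close> makes the inverse a total Borel function;
    continuity at points of the open set \<open>U\<close> is unaffected.\<close>
  define \<psi> where "\<psi> = (\<lambda>w. if w \<in> U then h w else 0)"
  have h\<phi>: "h (\<phi> z) = z" for z
    using g ghat by (simp add: h_def \<phi>_def latent_map_left_inverse)
  have \<phi>_U: "\<phi> z \<in> U" for z by (simp add: \<phi>_def U_def)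
  have U: "open U" and h_bij: "bij_betw h U UNIV" and h3: "Ck_on 3 h U"
    and inv3: "Ck_on 3 (inv_into U h) UNIV"
    using diffeo by (auto simp: Ck_diffeomorphism_def h_def U_def)
  \<comment> \<open>Thus the smoothness of the inverse of the diffeomorphism \<open>h\<close>
    becomes smoothness of \<open>\<phi>\<close>.\<close>
  have "inv_into U h = \<phi>"
  proof
    fix z show "inv_into U h z = \<phi> z"
      using h_bij \<phi>_U h\<phi> by (intro inv_into_f_eq) (auto simp: bij_betw_def)
  qed
  then have \<phi>3: "Ck_on 3 \<phi> UNIV" using inv3 by simp
  have \<phi>1: "Ck_on 1 \<phi> UNIV" and \<phi>_cont: "continuous_on UNIV \<phi>"
    using Ck_on_mono[OF \<phi>3, of 1] Ck_on_mono[OF \<phi>3, of 0] by simp_all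
  have h2: "Ck_on 2 h U" and h_cont: "continuous_on U h"
    using Ck_on_mono[OF h3, of 2] Ck_on_mono[OF h3, of 0] by simp_all
  have \<phi>h: "\<phi> (h w) = w" if "w \<in> U" for w
    using that h\<phi> by (auto simp: U_def \<phi>_def)
  have \<phi>_inj: "inj \<phi>" by (metis h\<phi> injI)
  have \<psi>_eq: "\<psi> w = h w" if "w \<in> U" for w using that by (simp add: \<psi>_def)
  have \<psi>\<phi>: "\<psi> (\<phi> z) = z" for z using \<phi>_U h\<phi> by (simp add: \<psi>_eq)
  have \<psi>_meas: "\<psi> \<in> borel_measurable borel"
    unfolding \<psi>_def using U h_cont by (intro borel_measurable_continuous_on_if) auto
  have \<psi>_cont: "isCont \<psi> w" if "w \<in> U" for w
  proof -
    have "continuous_on U \<psi>" using h_cont by (simp add: \<psi>_eq cong: continuous_on_cong)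
    then show ?thesis using U that by (simp add: continuous_on_eq_continuous_at)
  qed
  have Zhat: "Zhat (u r) s \<omega> = \<phi> (Z (u r) s \<omega>)" if "r \<in> {1..m}" "\<omega> \<in> space (M (u r))" for r s \<omega>
    using that by (simp add: zhat_def x_def \<phi>_def)

  \<comment> \<open>Regularity of the log densities\<close>
  have p_exp: "p (u r) t k x y = exp (\<eta> k r x y)" if "r \<in> {1..m}" for r k x y
    using cond_density_pos[OF that] by (simp add: eta_def[OF that] log_density_def)
  have \<eta>_cur: "has_pd_cur (\<eta> k r)" "has_pd_cur (pd_cur (\<eta> k r))"
    and \<eta>_prev: "has_pd_prev l (\<eta> k r)" "has_pd_cur (pd_prev l (\<eta> k r))"
      "has_pd_cur (pd_cur (pd_prev l (\<eta> k r)))" if "r \<in> {1..m}" for r k l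
    using partials[OF that, of k] by (auto simp: partials_exist_def)
  have p_cont: "continuous_on UNIV (\<lambda>x. p (u r) t k x y)" if r: "r \<in> {1..m}" for r k y
    unfolding p_exp[OF r]
    by (intro continuous_on_exp continuous_at_imp_continuous_on ballI
        DERIV_isCont[OF has_pd_cur_DERIV[OF \<eta>_cur(1)[OF r]]])
  have \<eta>_meas: "\<eta> k r x \<in> borel_measurable borel" if r: "r \<in> {1..m}" for r k x
  proof -
    have "(\<lambda>(x, y). p (u r) t k x y) \<in> borel_measurable (borel \<Otimes>\<^sub>M borel)"
      using process[OF r] t by (simp add: lag_one_process_def)
    from measurable_compose[OF measurable_Pair1'[of x] this]
    have "(\<lambda>y. p (u r) t k x y) \<in> borel_measurable borel" by simp
    then have "(\<lambda>y. ln (p (u r) t k x y)) \<in> borel_measurable borel" by (rule borel_measurable_ln)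
    then show ?thesis by (simp add: eta_def[OF r] log_density_def[abs_def])
  qed

  \<comment> \<open>Alternating sums over the corners of a rectangle\<close>
  define D where "D e c i j a b =
      (\<Sum>k\<in>UNIV. e k (h (corner c i j a b False False) $ k) + e k (h (corner c i j a b True True) $ k)
        - e k (h (corner c i j a b True False) $ k) - e k (h (corner c i j a b False True) $ k))"
    for e :: "'n \<Rightarrow> real \<Rightarrow> real" and c i j a b
  \<comment> \<open>Applied to the log densities, \<open>exp\<close> of \<open>D\<close> is the
    cross ratio of the joint densities at the corners, which for almost every \<open>y\<close> is
    the limit of a sequence common to all contexts.\<close>
  have D_const: "D (\<lambda>k x. \<eta> k r x y) c i j a b = D (\<lambda>k x. \<eta> k r' x y') c i j a b"
    if r: "r \<in> {1..m}" "r' \<in> {1..m}" and ij: "i \<noteq> j"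
      and inU: "\<And>s s'. corner c i j a b s s' \<in> U" for r r' y y' c i j a b
  proof -
    let ?w = "corner c i j a b"
    define \<kappa> where "\<kappa> n s s' = measure lborel (box_preimage \<phi> n (?w s s'))" for n s s'
    define R where "R n = (\<kappa> n True False * \<kappa> n False True) / (\<kappa> n False False * \<kappa> n True True)" for n
    have lim: "AE y in lborel. R \<longlonglongrightarrow> exp (D (\<lambda>k x. \<eta> k r x y) c i j a b)" if r: "r \<in> {1..m}" for r
    proof -
      obtain q where q: "\<And>y. 0 < q y" "distributed (M (u r)) lborel (Z (u r) (t - 1)) (\<lambda>y. ennreal (q y))"
        using prev_density[OF r] by blast
      have \<psi>w: "\<phi> (\<psi> (?w s s')) = ?w s s'" "isCont \<psi> (?w s s')" for s s'
        using inU[of s s'] by (simp_all add: \<psi>_eq \<phi>h \<psi>_cont)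
      let ?f = "\<lambda>y z. \<Prod>k\<in>UNIV. p (u r) t k (z $ k) y"
      have "AE y in lborel. R \<longlonglongrightarrow>
          (?f y (\<psi> (?w False False)) * ?f y (\<psi> (?w True True))) /
          (?f y (\<psi> (?w True False)) * ?f y (\<psi> (?w False True)))"
        unfolding R_def \<kappa>_def
        by (rule lag_one_cross_ratio_limit[OF process[OF r] t \<phi>_cont \<psi>_meas \<psi>\<phi> _ indep_zhat[OF r] q
              cond_density_pos[OF r] p_cont[OF r] \<psi>w ij]) (simp add: Zhat[OF r])
      moreover have "(?f y (\<psi> (?w False False)) * ?f y (\<psi> (?w True True))) /
          (?f y (\<psi> (?w True False)) * ?f y (\<psi> (?w False True))) = exp (D (\<lambda>k x. \<eta> k r x y) c i j a b)" for y
        by (simp add: p_exp[OF r] \<psi>_eq[OF inU] D_def sum.distrib sum_subtractf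
            exp_sum[symmetric] exp_add exp_diff)
      ultimately show ?thesis by simp
    qed
    \<comment> \<open>One good previous state in context 1 serves as reference value; it exists
      since the whole space is not null.\<close>
    have ex: "\<exists>y0. R \<longlonglongrightarrow> exp (D (\<lambda>k x. \<eta> k 1 x y0) c i j a b)"
    proof (rule ccontr)
      assume "\<not> ?thesis"
      then have "AE y :: real ^ 'n in lborel. False" using lim[of 1] m by auto
      then show False using AE_iff_null_sets[of "UNIV :: (real ^ 'n) set" lborel]
        by (simp add: null_sets_def emeasure_lborel_UNIV)
    qed
    then obtain y0 where y0: "R \<longlonglongrightarrow> exp (D (\<lambda>k x. \<eta> k 1 x y0) c i j a b)" ..
    \<comment> \<open>Uniqueness of limits gives the equality for almost every \<open>y\<close>;
      separate continuity extends it to every \<open>y\<close>.\<close>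
    have eq_y0: "D (\<lambda>k x. \<eta> k r x y) c i j a b = D (\<lambda>k x. \<eta> k 1 x y0) c i j a b" if r: "r \<in> {1..m}" for r y
    proof (rule AE_lborel_const_separately_continuous[where f = "\<lambda>y. D (\<lambda>k x. \<eta> k r x y) c i j a b"])
      show "(\<lambda>y. D (\<lambda>k x. \<eta> k r x y) c i j a b) \<in> borel_measurable borel"
        unfolding D_def by (intro borel_measurable_sum borel_measurable_diff borel_measurable_add \<eta>_meas[OF r])
      show "continuous_on UNIV (\<lambda>s. D (\<lambda>k x. \<eta> k r x (y + s *\<^sub>R b')) c i j a b)"
        if b': "b' \<in> Basis" for y b' :: "real ^ 'n"
      proof -
        obtain l where "b' = axis l 1" using b' by (auto simp: Basis_vec_def)
        then show ?thesis unfolding D_def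
          by (simp only:) (intro continuous_on_sum continuous_on_diff continuous_on_add
              has_pd_prev_continuous_on \<eta>_prev(1)[OF r])
      qed
      show "AE y in lborel. D (\<lambda>k x. \<eta> k r x y) c i j a b = D (\<lambda>k x. \<eta> k 1 x y0) c i j a b"
        using lim[OF r]
      proof eventually_elim
        case (elim y)
        from LIMSEQ_unique[OF this y0] show ?case by simp
      qed
    qed
    show ?thesis by (rule trans[OF eq_y0[OF r(1)] eq_y0[OF r(2), symmetric]])
  qed

  \<comment> \<open>Second-order relations and linear independence\<close>
  let ?dh = "\<lambda>i x. frechet_derivative h (at x) (axis i 1)"
  have rows: "?dh i c $ k * ?dh j c $ k = 0" if c: "c \<in> U" and ij: "i \<noteq> j" for c i j k
  proof -
    \<comment> \<open>These coefficients depend on \<open>c\<close>, \<open>i\<close>,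
      \<open>j\<close>, but not on the previous state or the entry of the stacked vectors, so they
      count as constants in \<open>lin_indep_functions\<close>.\<close>
    define \<alpha> where "\<alpha> k = frechet_derivative (?dh i) (at c) (axis j 1) $ k" for k
    define \<alpha>' where "\<alpha>' k = ?dh i c $ k * ?dh j c $ k" for k
    have second_order: "(\<Sum>k\<in>UNIV. \<alpha> k * F' k (h c $ k) + \<alpha>' k * F'' k (h c $ k)) = 0"
      if "\<And>k x. (F k has_real_derivative F' k x) (at x)"
        "\<And>k x. (F' k has_real_derivative F'' k x) (at x)"
        and D0: "\<And>a b. (\<And>s s'. corner c i j a b s s' \<in> U) \<Longrightarrow> D F c i j a b = 0"
      for F F' F'' :: "'n \<Rightarrow> real \<Rightarrow> real"
    proof -
      have "(\<Sum>k\<in>UNIV. F'' k (h c $ k) * (?dh i c $ k * ?dh j c $ k) +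
          F' k (h c $ k) * frechet_derivative (?dh i) (at c) (axis j 1) $ k) = 0"
      proof (rule vanishing_cross_difference_imp[OF U c h2 that(1,2)])
        fix a b
        assume corners: "c + a *\<^sub>R axis i 1 \<in> U" "c + b *\<^sub>R axis j 1 \<in> U"
          "c + a *\<^sub>R axis i 1 + b *\<^sub>R axis j 1 \<in> U"
        then have "D F c i j a b = 0" using c by (intro D0) (auto simp: corner_def)
        then show "(\<Sum>k\<in>UNIV. F k (h c $ k)) + (\<Sum>k\<in>UNIV. F k (h (c + a *\<^sub>R axis i 1 + b *\<^sub>R axis j 1) $ k)) =
          (\<Sum>k\<in>UNIV. F k (h (c + a *\<^sub>R axis i 1) $ k)) + (\<Sum>k\<in>UNIV. F k (h (c + b *\<^sub>R axis j 1) $ k))"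
          by (simp add: D_def corner_def sum.distrib sum_subtractf)
      qed
      then show ?thesis by (simp add: \<alpha>_def \<alpha>'_def mult.commute add.commute)
    qed
    have "(\<Sum>k\<in>UNIV. \<alpha> k * s_vec (\<eta> k) (h c $ k) y ent + \<alpha>' k * s_ring_vec (\<eta> k) (h c $ k) y ent) = 0"
      if "ent \<in> entries m" for y ent
    proof (cases ent)
      case (Inl rl)
      obtain r l where rl: "rl = (r, l)" by (cases rl)
      have r: "r \<in> {1..m}" using that Inl rl by (auto simp: entries_def)
      \<comment> \<open>Since \<open>D\<close> is linear in its first argument, this is the
        derivative in the previous state of a quantity that is constant by \<open>D_const\<close>.
        Differentiating in the previous state first yields the mixed derivatives in the order used
        by \<open>s_vec\<close>.\<close>
      have "D (\<lambda>k x. pd_prev l (\<eta> k r) x y) c i j a b = 0"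
        if inU: "\<And>s s'. corner c i j a b s s' \<in> U" for a b
      proof (rule DERIV_locally_const_imp_zero[OF _ zero_less_one])
        show "((\<lambda>s. D (\<lambda>k x. \<eta> k r x (y + s *\<^sub>R axis l 1)) c i j a b) has_real_derivative
            D (\<lambda>k x. pd_prev l (\<eta> k r) x y) c i j a b) (at 0)"
          unfolding D_def
          by (intro DERIV_sum DERIV_diff DERIV_add has_pd_prev_DERIV \<eta>_prev(1)[OF r])
      qed (rule D_const[OF r r ij inU])
      from second_order[OF has_pd_cur_DERIV[OF \<eta>_prev(2)[OF r]] has_pd_cur_DERIV[OF \<eta>_prev(3)[OF r]] this]
      show ?thesis by (simp add: Inl rl s_vec_def s_ring_vec_def)
    next
      case (Inr r)
      \<comment> \<open>Difference entries start at 2, so \<open>r - 1\<close> is again a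
        context.\<close>
      have r: "r \<in> {1..m}" "r - 1 \<in> {1..m}" using that Inr by (auto simp: entries_def)
      have "D (\<lambda>k x. \<eta> k r x y - \<eta> k (r - 1) x y) c i j a b = 0"
        if inU: "\<And>s s'. corner c i j a b s s' \<in> U" for a b
      proof -
        have "D (\<lambda>k x. \<eta> k r x y - \<eta> k (r - 1) x y) c i j a b =
            D (\<lambda>k x. \<eta> k r x y) c i j a b - D (\<lambda>k x. \<eta> k (r - 1) x y) c i j a b"
          unfolding D_def by (simp add: sum.distrib sum_subtractf)
        then show ?thesis using D_const[OF r ij inU] by simp
      qed
      from second_order[OF DERIV_diff[OF has_pd_cur_DERIV[OF \<eta>_cur(1)[OF r(1)]] has_pd_cur_DERIV[OF \<eta>_cur(1)[OF r(2)]]]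
          DERIV_diff[OF has_pd_cur_DERIV[OF \<eta>_cur(2)[OF r(1)]] has_pd_cur_DERIV[OF \<eta>_cur(2)[OF r(2)]]] this]
      show ?thesis by (simp add: Inr s_vec_def s_ring_vec_def)
    qed
    \<comment> \<open>Independence is used at the current state \<open>h c\<close>; the vanishing of
      \<open>\<alpha>'\<close> is the row condition.\<close>
    then have "\<forall>k. \<alpha> k = 0 \<and> \<alpha>' k = 0"
      using lin_indep[of "h c"] unfolding lin_indep_functions_def by blast
    then show ?thesis by (simp add: \<alpha>'_def)
  qed

  \<comment> \<open>Component-wise form of \<open>\<phi>\<close>\<close>
  have mono: "\<exists>\<pi>. \<pi> permutes UNIV \<and>
      (\<forall>i l. frechet_derivative \<phi> (at z) (axis l 1) $ i \<noteq> 0 \<longleftrightarrow> l = \<pi> i)" for z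
  proof -
    have \<phi>_diff: "\<phi> differentiable (at z)" using \<phi>1 by simp
    have h_diff: "h differentiable (at (\<phi> z))" using h2 \<phi>_U[of z] by (simp add: numeral_2_eq_2)
    show ?thesis
      \<comment> \<open>Here \<open>J\<close> is the derivative of \<open>h\<close> at
        \<open>\<phi> z\<close> and \<open>K\<close> that of \<open>\<phi>\<close> at
        \<open>z\<close>, so the row condition on \<open>h\<close> becomes a permutation pattern for
        \<open>\<phi>\<close>.\<close>
      by (rule linear_inverse_of_monomial_rows[OF linear_frechet_derivative[OF h_diff]
            frechet_derivative_left_inverse[of h \<phi> z, OF h\<phi> \<phi>_diff h_diff] rows[OF \<phi>_U[of z]]]) blast+
  qed
  obtain \<pi> T where \<pi>T: "\<pi> permutes UNIV" "\<And>k. inj (T k)" "\<And>z k. \<phi> z $ k = T k (z $ \<pi> k)"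
    using monomial_derivative_imp_componentwise[OF \<phi>1 \<phi>_inj mono] by metis
  have "ghat (g z) $ k = T k (z $ \<pi> k)" for z k using \<pi>T(3)[of z k] by (simp add: \<phi>_def)
  then show ?thesis
    using \<pi>T(1,2) Zhat \<pi>T(3) by (intro exI[of _ \<pi>] exI[of _ T]) auto
qed

end
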